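(* Let $0<\mu\le L$, $\varrho=\mu/L$, and $\sigma\in[0,1)$. Consider the AugDGM algorithm $$x_i(k+1)=\sum_{j\in\mathcal N_i}w_{ij}\left[x_j(k)-\alpha y_j(k)\right],\qquad y_i(k+1)=\sum_{j\in\mathcal N_i}w_{ij}\left[y_j(k)+\nabla f_j(x_j(k+1))-\nabla f_j(x_j(k))\right],\qquad i=1,\dots,N,$$ with $x_i(0)\in\mathbb R^d$ arbitrary and $y_i(0)=\nabla f_i(x_i(0))$, for the class $\mathcal F_{\mu,L}$ of objective functions over the class $\{\mathcal G\}_\sigma$ of graphs. Let $\gamma(\alpha)$ be its worst-case convergence rate with step size $\alpha$. Then the optimal worst-case convergence rate $\min_{\alpha>0}\gamma(\alpha)$ equals $$\gamma_{AD}^{*}=\begin{cases}\dfrac{L-\mu}{L+\mu}, & \text{if } 0\le\sigma\le\dfrac{1-\varrho}{3+\varrho},\\[2mm] \dfrac{\sigma\varrho+\sigma\sqrt{\varrho+\sigma^2-\sigma^2\varrho}}{\sigma^2+\varrho}, & \text{if } \dfrac{1-\varrho}{3+\varrho}\le\sigma<1,\end{cases}$$ and it is attained with the step size $\alpha_{AD}^{*}=\dfrac{1-\gamma_{AD}^{*}}{\mu}$.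
   Context: The problem is $\min_{x\in\mathbb R^d}\sum_{i=1}^N f_i(x)$ with $N\ge 2$ agents, agent $i$ holding a local copy $x_i\in\mathbb R^d$ and an auxiliary variable $y_i\in\mathbb R^d$. Write $\boldsymbol x=(x_1,\dots,x_N)\in\mathbb R^{Nd}$ and $\boldsymbol f(\boldsymbol x)=\sum_{i=1}^N f_i(x_i)$. Function class: $\boldsymbol f\in\mathcal F_{\mu,L}$ means that each $f_i:\mathbb R^d\to\mathbb R$ is differentiable, $\mu$-strongly convex and $L$-smooth, i.e. for all $x,y\in\mathbb R^d$: $f_i(x)+\nabla f_i(x)^T(y-x)+\frac{\mu}{2}\|y-x\|^2\le f_i(y)\le f_i(x)+\nabla f_i(x)^T(y-x)+\frac L2\|y-x\|^2$. Graph class: a graph $\mathcal G$ is an undirected graph on $N$ nodes with adjacency (weight) matrix $W=(w_{ij})\in\mathbb R^{N\times N}$, where $w_{ij}>0$ if $j\in\mathcal N_i$ (the neighbour set of $i$) and $w_{ij}=0$ otherwise, such that $W=W^T$, $W\mathbf 1=\mathbf 1$, and $\|W\|_s:=\rho\left(W-\frac{\mathbf 1\mathbf 1^T}{N}\right)<1$ ($\rho$ = spectral radius). $\{\mathcal G\}_\sigma$ is the set of all such (connected) graphs with $\|W\|_s\le\sigma$. Worst-case rate: the algorithm with step size $\alpha$ is said to converge at the worst-case convergence rate $\gamma$ if $\lim_{k\to\infty}r^{-k}(\boldsymbol x(k)-\boldsymbol x^* )=\mathbf 0$ for all $r\in(\gamma,1]$, for every $\boldsymbol f\in\mathcal F_{\mu,L}$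 and every $\mathcal G\in\{\mathcal G\}_\sigma$ (and every initialization as specified), where $\boldsymbol x^*=\mathbf 1_N\otimes x^*$ is the stationary point, $x^*$ being the minimizer of $\sum_i f_i$. $\gamma(\alpha)$ denotes the smallest $\gamma\in[0,1)$ with this property (and $\gamma(\alpha)$ is not less than $1$ if there is none). *)

theory Defs
  imports "HOL-Analysis.Analysis"
begin

text \<open>
  The agents are the elements of a finite type \<open>'n\<close>, and the decision variable lives in
  \<open>real^'d\<close>; both types are fixed but arbitrary. A stacked vector is an element of
  \<open>(real^'d)^'n\<close>, whose component \<open>x $ i\<close> belongs to agent \<open>i\<close>.
\<close>

subsection \<open>Objective functions\<close>

definition gradient :: "('a::real_inner \<Rightarrow> real) \<Rightarrow> 'a \<Rightarrow> 'a" where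
  "gradient f x = (THE D. GDERIV f x :> D)"

lemma gradient_eqI: "gradient f x = D" if "GDERIV f x :> D"
  unfolding gradient_def
proof (rule the_equality)
  fix E assume "GDERIV f x :> E"
  then have "(\<lambda>h. h \<bullet> E) = (\<lambda>h. h \<bullet> D)"
    using that unfolding gderiv_def by (rule has_derivative_unique)
  then have "h \<bullet> E = h \<bullet> D" for h by meson
  then show "E = D" by (metis inner_commute vector_eq_rdot)
qed (fact that)

lemma GDERIV_gradient:
  fixes f :: "'a::euclidean_space \<Rightarrow> real"
  assumes "f differentiable (at x)"
  shows "GDERIV f x :> gradient f x"
proof -
  obtain f' where f': "(f has_derivative f') (at x)"
    using assms by (auto simp: differentiable_def)
  then have "linear f'"
    by (rule has_derivative_linear)
  then have "f' h = h \<bullet> adjoint f' 1" for h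
    using adjoint_works[of f' h 1] by (simp add: inner_real_def)
  then have "f' = (\<lambda>h. h \<bullet> adjoint f' 1)" by (rule ext)
  with f' have "GDERIV f x :> adjoint f' 1"
    unfolding gderiv_def by metis
  then show ?thesis by (simp add: gradient_eqI)
qed

definition strongly_convex_smooth ::
    "real \<Rightarrow> real \<Rightarrow> ('n::finite \<Rightarrow> real^'d::finite \<Rightarrow> real) set" where
  "strongly_convex_smooth \<mu> L = {f. \<forall>i.
     (\<forall>x. f i differentiable (at x)) \<and>
     (\<forall>x y. f i x + gradient (f i) x \<bullet> (y - x) + \<mu> / 2 * (norm (y - x))\<^sup>2 \<le> f i y \<and>
            f i y \<le> f i x + gradient (f i) x \<bullet> (y - x) + L / 2 * (norm (y - x))\<^sup>2)}"

text \<open>The consensus point: all agents hold the minimizer of the sum of the local objectives.\<close>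

definition consensus_optimum ::
    "('n::finite \<Rightarrow> real^'d::finite \<Rightarrow> real) \<Rightarrow> (real^'d)^'n" where
  "consensus_optimum f = (\<chi> i. ARG_MIN (\<lambda>z. \<Sum>j\<in>UNIV. f j z) z. True)"

subsection \<open>Graphs\<close>

text \<open>
  For a matrix with real entries the eigenvalues are those of its complexification
  (\<open>map_matrix complex_of_real\<close>).
\<close>

definition spectral_radius :: "complex^'n^'n::finite \<Rightarrow> real" where
  "spectral_radius A = Sup {cmod z | z. \<exists>v. v \<noteq> 0 \<and> A *v v = z *s v}"

definition consensus_norm :: "real^'n^'n::finite \<Rightarrow> real" where
  "consensus_norm W =
     spectral_radius (map_matrix complex_of_real (W - (\<chi> i j. 1 / real CARD('n))))"

text \<open>
  A weighted graph is a pair of a neighbourhood function and a weight matrix.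
  A node may be its own neighbour: without self-loops, the averaging matrix
  (the only admissible \<open>W\<close> for \<open>\<sigma> = 0\<close>) would be excluded.
\<close>

definition graph_class :: "real \<Rightarrow> (('n::finite \<Rightarrow> 'n set) \<times> (real^'n^'n)) set" where
  "graph_class \<sigma> = {(nb, W).
     (\<forall>i j. j \<in> nb i \<longleftrightarrow> i \<in> nb j) \<and>
     {(i, j). j \<in> nb i}\<^sup>* = UNIV \<and>
     (\<forall>i j. (j \<in> nb i \<longrightarrow> W $ i $ j > 0) \<and> (j \<notin> nb i \<longrightarrow> W $ i $ j = 0)) \<and>
     transpose W = W \<and> W *v 1 = 1 \<and>
     consensus_norm W < 1 \<and> consensus_norm W \<le> \<sigma>}"

subsection \<open>The algorithm and its worst-case rate\<close>

definition AugDGM ::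
    "('n::finite \<Rightarrow> 'n set) \<Rightarrow> real^'n^'n \<Rightarrow> ('n \<Rightarrow> real^'d::finite \<Rightarrow> real) \<Rightarrow> real \<Rightarrow>
     (nat \<Rightarrow> (real^'d)^'n) \<Rightarrow> (nat \<Rightarrow> (real^'d)^'n) \<Rightarrow> bool" where
  "AugDGM nb W f \<alpha> x y \<longleftrightarrow>
     (\<forall>i. y 0 $ i = gradient (f i) (x 0 $ i)) \<and>
     (\<forall>k i. x (Suc k) $ i = (\<Sum>j\<in>nb i. W $ i $ j *\<^sub>R (x k $ j - \<alpha> *\<^sub>R y k $ j))) \<and>
     (\<forall>k i. y (Suc k) $ i =
        (\<Sum>j\<in>nb i. W $ i $ j *\<^sub>R
           (y k $ j + gradient (f j) (x (Suc k) $ j) - gradient (f j) (x k $ j))))"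

definition converges_at_rate ::
    "'n::finite itself \<Rightarrow> 'd::finite itself \<Rightarrow> real \<Rightarrow> real \<Rightarrow> real \<Rightarrow> real \<Rightarrow> real \<Rightarrow> bool" where
  "converges_at_rate TYPE('n) TYPE('d) \<mu> L \<sigma> \<alpha> \<gamma> \<longleftrightarrow>
     (\<forall>r \<in> {\<gamma><..1}.
      \<forall>f \<in> (strongly_convex_smooth \<mu> L :: ('n \<Rightarrow> real^'d \<Rightarrow> real) set).
      \<forall>(nb, W) \<in> graph_class \<sigma>.
      \<forall>x y. AugDGM nb W f \<alpha> x y \<longrightarrow>
        (\<lambda>k. r powi (- int k) *\<^sub>R (x k - consensus_optimum f)) \<longlonglongrightarrow> 0)"

text \<open>The value 1 encodes that there is no rate in \<open>[0,1)\<close>.\<close>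

definition worst_case_rate ::
    "'n::finite itself \<Rightarrow> 'd::finite itself \<Rightarrow> real \<Rightarrow> real \<Rightarrow> real \<Rightarrow> real \<Rightarrow> real" where
  "worst_case_rate TYPE('n) TYPE('d) \<mu> L \<sigma> \<alpha> =
     (if \<exists>\<gamma>\<in>{0..<1}. converges_at_rate TYPE('n) TYPE('d) \<mu> L \<sigma> \<alpha> \<gamma>
      then LEAST \<gamma>. \<gamma> \<in> {0..<1} \<and> converges_at_rate TYPE('n) TYPE('d) \<mu> L \<sigma> \<alpha> \<gamma>
      else 1)"

text \<open>The \<open>LEAST\<close> above is always a genuine minimum.\<close>

lemma worst_case_rate_least:
  assumes "\<gamma>\<^sub>0 \<in> {0..<1}" "converges_at_rate TYPE('n::finite) TYPE('d::finite) \<mu> L \<sigma> \<alpha> \<gamma>\<^sub>0"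
  shows "worst_case_rate TYPE('n) TYPE('d) \<mu> L \<sigma> \<alpha> \<in> {0..<1}"
    and "converges_at_rate TYPE('n) TYPE('d) \<mu> L \<sigma> \<alpha> (worst_case_rate TYPE('n) TYPE('d) \<mu> L \<sigma> \<alpha>)"
    and "worst_case_rate TYPE('n) TYPE('d) \<mu> L \<sigma> \<alpha> \<le> \<gamma>\<^sub>0"
proof -
  let ?C = "converges_at_rate TYPE('n) TYPE('d) \<mu> L \<sigma> \<alpha>"
  let ?P = "\<lambda>\<gamma>. \<gamma> \<in> {0..<1} \<and> ?C \<gamma>"
  define g where "g = Inf (Collect ?P)"
  have P0: "?P \<gamma>\<^sub>0" using assms by simp
  have bdd: "bdd_below (Collect ?P)" by (rule bdd_belowI[of _ 0]) auto
  have g_le: "g \<le> \<gamma>" if "?P \<gamma>" for \<gamma>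
    unfolding g_def using that bdd by (intro cInf_lower) auto
  have g_ge: "g \<ge> 0"
    unfolding g_def using P0 by (intro cInf_greatest) auto
  have ex: "\<exists>\<gamma>. ?P \<gamma> \<and> \<gamma> < r" if "g < r" for r
    using cInf_lessD[of "Collect ?P" r] P0 that unfolding g_def by blast
  have "?C g"
    unfolding converges_at_rate_def
  proof (rule ballI)
    fix r assume r: "r \<in> {g<..1}"
    then obtain \<gamma> where "?C \<gamma>" "r \<in> {\<gamma><..1}" using ex[of r] by auto
    then show "\<forall>f \<in> (strongly_convex_smooth \<mu> L :: ('n \<Rightarrow> real^'d \<Rightarrow> real) set).
      \<forall>(nb, W) \<in> graph_class \<sigma>. \<forall>x y. AugDGM nb W f \<alpha> x y \<longrightarrow>
        (\<lambda>k. r powi (- int k) *\<^sub>R (x k - consensus_optimum f)) \<longlonglongrightarrow> 0"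
      unfolding converges_at_rate_def by (rule bspec)
  qed
  then have "?P g" using g_ge g_le[OF P0] P0 by auto
  then have "(LEAST \<gamma>. ?P \<gamma>) = g" by (rule Least_equality) (rule g_le)
  then have "worst_case_rate TYPE('n) TYPE('d) \<mu> L \<sigma> \<alpha> = g"
    using P0 unfolding worst_case_rate_def by auto
  then show "worst_case_rate TYPE('n) TYPE('d) \<mu> L \<sigma> \<alpha> \<in> {0..<1}"
    and "converges_at_rate TYPE('n) TYPE('d) \<mu> L \<sigma> \<alpha> (worst_case_rate TYPE('n) TYPE('d) \<mu> L \<sigma> \<alpha>)"
    and "worst_case_rate TYPE('n) TYPE('d) \<mu> L \<sigma> \<alpha> \<le> \<gamma>\<^sub>0"
    using \<open>?P g\<close> g_le[OF P0] by simp_all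
qed

subsection \<open>The optimal rate\<close>

definition gamma_AD :: "real \<Rightarrow> real \<Rightarrow> real \<Rightarrow> real" where
  "gamma_AD \<mu> L \<sigma> =
     (let \<rho> = \<mu> / L in
      if \<sigma> \<le> (1 - \<rho>) / (3 + \<rho>) then (L - \<mu>) / (L + \<mu>)
      else (\<sigma> * \<rho> + \<sigma> * sqrt (\<rho> + \<sigma>\<^sup>2 - \<sigma>\<^sup>2 * \<rho>)) / (\<sigma>\<^sup>2 + \<rho>))"

text \<open>The two formulas agree at the boundary between the cases.\<close>

lemma gamma_AD_second_case:
  assumes "0 < \<mu>" "\<mu> \<le> L" "\<rho> = \<mu> / L" "(1 - \<rho>) / (3 + \<rho>) \<le> \<sigma>"
  shows "gamma_AD \<mu> L \<sigma> =
    (\<sigma> * \<rho> + \<sigma> * sqrt (\<rho> + \<sigma>\<^sup>2 - \<sigma>\<^sup>2 * \<rho>)) / (\<sigma>\<^sup>2 + \<rho>)"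
proof (cases "\<sigma> = (1 - \<rho>) / (3 + \<rho>)")
  case True
  have \<rho>: "0 < \<rho>" "\<rho> \<le> 1" and \<mu>: "\<mu> = \<rho> * L" and L: "L > 0" using assms by auto
  have sq: "\<rho> + \<sigma>\<^sup>2 - \<sigma>\<^sup>2 * \<rho> = ((1 + 3 * \<rho>) / (3 + \<rho>))\<^sup>2"
    unfolding True using \<rho> by (simp add: divide_simps) algebra
  have sqr: "sqrt (\<rho> + \<sigma>\<^sup>2 - \<sigma>\<^sup>2 * \<rho>) = (1 + 3 * \<rho>) / (3 + \<rho>)"
    unfolding sq using \<rho> by simp
  have num: "\<rho> + (1 + 3 * \<rho>) / (3 + \<rho>) = (1 + 6 * \<rho> + \<rho>\<^sup>2) / (3 + \<rho>)"
    using \<rho> by (simp add: field_simps power2_eq_square)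
  have den: "\<sigma>\<^sup>2 + \<rho> = (1 + \<rho>) * (1 + 6 * \<rho> + \<rho>\<^sup>2) / (3 + \<rho>)\<^sup>2"
    unfolding True using \<rho> by (simp add: divide_simps) algebra
  have pos: "1 + 6 * \<rho> + \<rho>\<^sup>2 > 0" "1 + \<rho> > 0" "3 + \<rho> > 0"
    using \<rho> by (auto intro!: add_pos_pos)
  have cancel: "(a / c) * (q / c) / (b * q / c\<^sup>2) = a / b"
    if "q > 0" "b > 0" "c > 0" for a b c q :: real
    using that by (simp add: power2_eq_square)
  have "(\<sigma> * \<rho> + \<sigma> * sqrt (\<rho> + \<sigma>\<^sup>2 - \<sigma>\<^sup>2 * \<rho>)) / (\<sigma>\<^sup>2 + \<rho>)
      = \<sigma> * ((1 + 6 * \<rho> + \<rho>\<^sup>2) / (3 + \<rho>)) / (\<sigma>\<^sup>2 + \<rho>)"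
    by (simp only: sqr num flip: distrib_left)
  also have "\<dots> = (1 - \<rho>) / (1 + \<rho>)"
    unfolding den unfolding True by (rule cancel[OF pos])
  also have "\<dots> = (L - \<mu>) / (L + \<mu>)"
  proof -
    have "L - \<mu> = L * (1 - \<rho>)" "L + \<mu> = L * (1 + \<rho>)"
      unfolding \<mu> by (simp_all add: algebra_simps)
    then show ?thesis using L by simp
  qed
  finally show ?thesis using True assms by (simp add: gamma_AD_def Let_def)
next
  case False
  then show ?thesis using assms by (auto simp: gamma_AD_def Let_def)
qed

end

theory Submission
  imports Defs
begin

text \<open>
  Split a stacked vector into its mean over the agents and its deviation from the mean, the
  disagreement. Since \<open>W\<close> preserves means and \<open>y\<close> starts at the gradients, the mean of \<open>y\<close> always
  equals the mean of the local gradients, and the mean of \<open>x\<close> moves by \<open>- \<alpha>\<close> times this mean. On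
  disagreements \<open>W\<close> contracts by \<open>\<sigma>\<close>, so there both updates are first-order recursions with factor
  \<open>\<sigma>\<close>, the second driven by differences of consecutive gradients.

  Upper bound. Measure a sequence \<open>s\<close> by the weighted norm whose square is the sum of
  \<open>|s k|\<^sup>2 / r\<^sup>2\<^sup>k\<close>; if the error has finite norm, it is \<open>o(r\<^sup>k)\<close>. Let \<open>m = (L + \<mu>) / 2\<close>,
  \<open>\<delta> = (L - \<mu>) / 2\<close>, let \<open>e\<close> be the error of \<open>x\<close> and \<open>h\<close> the corresponding change of the gradients.
  Cocoercivity gives \<open>|h - m e| \<le> \<delta> |e|\<close> (\<open>gradient_sector\<close>), both pointwise and in the weighted
  norm. The recursions give the opposite inequality separately for the mean and the disagreement:
  up to a constant that depends on the initial state only, the part of \<open>h - m e\<close> is at least \<open>\<delta>'\<close>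
  times the part of \<open>e\<close>. Some \<open>\<delta>' > \<delta>\<close> is possible for the mean if
  \<open>r > max (1 - \<alpha> \<mu>) (\<alpha> L - 1)\<close>, and for the disagreement if \<open>r > \<sigma>\<close> and
  \<open>(r - \<sigma>)\<^sup>2 > \<alpha> \<sigma>\<^sup>2 L (1 + r)\<close>. Hence the error has finite norm (\<open>AugDGM_converges\<close>). Both
  estimates use nothing but the triangle inequality: the factor of a shifted sequence is exactly
  \<open>r\<close>, and a difference of consecutive terms costs a factor \<open>1 + r\<close>.

  Lower bound. These conditions are sharp. For quadratic objectives with curvature \<open>m\<close> and an
  eigenvector of \<open>W\<close> with eigenvalue \<open>\<theta>\<close>, the algorithm has a geometric trajectory with ratio \<open>\<rho>\<close>
  whenever \<open>(\<rho> - \<theta>)\<^sup>2 = - \<alpha> \<theta>\<^sup>2 m (\<rho> - 1)\<close> (\<open>worst_case_rate_ge_mode\<close>). Taking \<open>\<theta> = 1\<close> yields the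
  ratios \<open>1 - \<alpha> \<mu>\<close> and \<open>1 - \<alpha> L\<close>, and \<open>\<theta> = - \<sigma>\<close> with \<open>m = L\<close> yields \<open>\<rho> = - s\<close> where
  \<open>(s - \<sigma>)\<^sup>2 = \<alpha> \<sigma>\<^sup>2 L (1 + s)\<close>.

  In \<open>\<alpha>\<close>, the bound \<open>1 - \<alpha> \<mu>\<close> decreases while \<open>\<alpha> L - 1\<close> and \<open>s\<close> increase. The best step size is
  therefore where \<open>1 - \<alpha> \<mu>\<close> meets the larger of the other two. At the meeting point
  \<open>\<alpha> = (1 - \<gamma>) / \<mu>\<close>; meeting \<open>\<alpha> L - 1\<close> gives the first formula for \<open>\<gamma>\<close> and meeting \<open>s\<close> the second
  one (\<open>gamma_AD_properties\<close>).
\<close>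

section \<open>Matrices acting on stacked vectors\<close>

text \<open>
  The Kronecker product of \<open>A\<close> with the identity, in the notation \<open>(A \<otimes> I) x\<close>.
\<close>

definition mix :: "real^'n^'m \<Rightarrow> ('a::real_vector)^'n \<Rightarrow> 'a^'m::finite" where
  "mix A x = (\<chi> i. \<Sum>j\<in>UNIV. A $ i $ j *\<^sub>R x $ j)"

definition averaging :: "real^'n^'n::finite" where
  "averaging = (\<chi> i j. 1 / real CARD('n))"

lemma mix_nth: "mix A x $ i = (\<Sum>j\<in>UNIV. A $ i $ j *\<^sub>R x $ j)"
  by (simp add: mix_def)

lemma mix_add: "mix A (x + y) = mix A x + mix A y"
  by (simp add: vec_eq_iff mix_nth scaleR_add_right sum.distrib)

lemma mix_diff: "mix A (x - y) = mix A x - mix A y"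
  by (simp add: vec_eq_iff mix_nth scaleR_diff_right sum_subtractf)

lemma mix_scaleR: "mix A (c *\<^sub>R x) = c *\<^sub>R mix A x"
  by (simp add: vec_eq_iff mix_nth scaleR_sum_right mult.commute)

lemma mix_diff_left: "mix (A - B) x = mix A x - mix B x"
  by (simp add: vec_eq_iff mix_nth scaleR_diff_left sum_subtractf)

lemma mix_mix: "mix A (mix B x) = mix (A ** B) x"
proof -
  have "(\<Sum>j\<in>UNIV. A $ i $ j *\<^sub>R (\<Sum>k\<in>UNIV. B $ j $ k *\<^sub>R x $ k))
      = (\<Sum>k\<in>UNIV. (\<Sum>j\<in>UNIV. A $ i $ j * B $ j $ k) *\<^sub>R x $ k)" for i
    unfolding scaleR_sum_right scaleR_scaleR scaleR_sum_left by (rule sum.swap)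
  then show ?thesis by (simp add: vec_eq_iff mix_nth matrix_matrix_mult_def)
qed

lemma inner_mix: "mix A x \<bullet> y = x \<bullet> mix (transpose A) y"
proof -
  have "(\<Sum>i\<in>UNIV. (\<Sum>j\<in>UNIV. A $ i $ j *\<^sub>R x $ j) \<bullet> y $ i)
      = (\<Sum>i\<in>UNIV. \<Sum>j\<in>UNIV. A $ i $ j * (x $ j \<bullet> y $ i))"
    by (simp add: inner_sum_left)
  also have "\<dots> = (\<Sum>j\<in>UNIV. \<Sum>i\<in>UNIV. A $ i $ j * (x $ j \<bullet> y $ i))"
    by (rule sum.swap)
  finally show ?thesis
    by (simp add: inner_vec_def mix_nth inner_sum_right transpose_def)
qed

lemma norm_vec_square: "(norm v)\<^sup>2 = (\<Sum>i\<in>UNIV. (norm (v $ i))\<^sup>2)"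
  unfolding norm_vec_def L2_set_def by (simp add: sum_nonneg)

text \<open>
  Each coordinate of the decision space is mixed by \<open>A\<close> on its own, and the squared norm is the sum
  over the coordinates.
\<close>

lemma norm_mix_le:
  fixes A :: "real^'n::finite^'n" and x :: "(real^'d::finite)^'n"
  assumes A: "\<And>v. norm (A *v v) \<le> s * norm v" and "0 \<le> s"
  shows "norm (mix A x) \<le> s * norm x"
proof -
  define c where "c d = (\<chi> i. x $ i $ d)" for d
  have sq: "(norm z)\<^sup>2 = (\<Sum>d\<in>UNIV. (norm (\<chi> i. z $ i $ d))\<^sup>2)" for z :: "(real^'d)^'n"
  proof -
    have "(norm z)\<^sup>2 = (\<Sum>i\<in>UNIV. \<Sum>d\<in>UNIV. (norm (z $ i $ d))\<^sup>2)"
      by (simp only: norm_vec_square)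
    also have "\<dots> = (\<Sum>d\<in>UNIV. \<Sum>i\<in>UNIV. (norm (z $ i $ d))\<^sup>2)" by (rule sum.swap)
    also have "\<dots> = (\<Sum>d\<in>UNIV. (norm (\<chi> i. z $ i $ d))\<^sup>2)"
      by (simp only: norm_vec_square[of "\<chi> i. z $ i $ d" for d] vec_lambda_beta)
    finally show ?thesis .
  qed
  have "(\<chi> i. mix A x $ i $ d) = A *v c d" for d
    by (simp add: vec_eq_iff mix_nth matrix_vector_mult_def c_def)
  then have "(norm (mix A x))\<^sup>2 = (\<Sum>d\<in>UNIV. (norm (A *v c d))\<^sup>2)" by (simp only: sq)
  also have "\<dots> \<le> (\<Sum>d\<in>UNIV. (s * norm (c d))\<^sup>2)"
    by (intro sum_mono power_mono A) simp
  also have "\<dots> = s\<^sup>2 * (norm x)\<^sup>2"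
    unfolding sq[of x] c_def power_mult_distrib sum_distrib_left ..
  finally have "(norm (mix A x))\<^sup>2 \<le> (s * norm x)\<^sup>2" by (simp add: power_mult_distrib)
  then show ?thesis by (rule power2_le_imp_le) (simp add: \<open>0 \<le> s\<close>)
qed

lemma mix_real: "mix A v = A *v v" for v :: "real^'n"
  by (simp add: mix_def matrix_vector_mult_def)

section \<open>Spectral radius of symmetric matrices\<close>

lemma cmod_eigenvalue_le_spectral_radius:
  fixes A :: "complex^'n::finite^'n"
  assumes "A *v v = z *s v" "v \<noteq> 0"
  shows "cmod z \<le> spectral_radius A"
proof -
  have norm_smult: "norm (z *s v) = cmod z * norm v" for z and v :: "complex^'n"
    by (simp add: norm_vec_def norm_mult L2_set_right_distrib)
  have "bounded_linear ((*v) A)" by simp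
  then obtain B where B: "\<And>v. norm (A *v v) \<le> norm v * B"
    using bounded_linear.bounded by blast
  have "cmod z \<le> B" if "A *v v = z *s v" "v \<noteq> 0" for z v
    using B[of v] that by (simp add: norm_smult mult.commute)
  then have "bdd_above {cmod z | z. \<exists>v. v \<noteq> 0 \<and> A *v v = z *s v}"
    by (intro bdd_aboveI[of _ B]) auto
  then show ?thesis
    unfolding spectral_radius_def using assms by (intro cSup_upper) auto
qed

lemma abs_eigenvalue_le_spectral_radius:
  fixes A :: "real^'n::finite^'n"
  assumes "A *v v = c *\<^sub>R v" "v \<noteq> 0"
  shows "\<bar>c\<bar> \<le> spectral_radius (map_matrix complex_of_real A)"
proof -
  let ?v = "\<chi> i. complex_of_real (v $ i)"
  have "(map_matrix complex_of_real A *v ?v) $ i = complex_of_real ((A *v v) $ i)" for i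
    by (simp add: matrix_vector_mult_def)
  then have "map_matrix complex_of_real A *v ?v = complex_of_real c *s ?v"
    using assms(1) by (simp add: vec_eq_iff)
  moreover have "?v \<noteq> 0" using assms(2) by (simp add: vec_eq_iff)
  ultimately show ?thesis
    using cmod_eigenvalue_le_spectral_radius by fastforce
qed

text \<open>
  Let \<open>v\<close> maximize \<open>|A v|\<close> on the unit sphere, with maximum \<open>M\<close>. Then
  \<open>|A\<^sup>2 v - M\<^sup>2 v|\<^sup>2 = |A\<^sup>2 v|\<^sup>2 - M\<^sup>4 \<le> 0\<close>, so \<open>(A - M) (A + M) v = 0\<close>, and either \<open>v\<close> itself or
  \<open>(A + M) v\<close> is an eigenvector, with eigenvalue \<open>- M\<close> or \<open>M\<close>.
\<close>

lemma symmetric_norm_le_spectral_radius: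
  fixes A :: "real^'n::finite^'n"
  assumes sym: "transpose A = A"
  shows "norm (A *v w) \<le> spectral_radius (map_matrix complex_of_real A) * norm w"
proof -
  have cont: "continuous_on (sphere 0 1) (\<lambda>v. norm (A *v v))"
    by (intro continuous_on_norm linear_continuous_on) simp
  obtain e :: "real^'n" where "norm e = 1" using vector_choose_size[of 1] by auto
  then have "sphere (0::real^'n) 1 \<noteq> {}" by (metis mem_sphere_0 empty_iff)
  from continuous_attains_sup[OF compact_sphere this cont]
  obtain v where "v \<in> sphere 0 1" "\<forall>w\<in>sphere 0 1. norm (A *v w) \<le> norm (A *v v)" by blast
  then have v: "norm v = 1" and max: "\<And>w. norm w = 1 \<Longrightarrow> norm (A *v w) \<le> norm (A *v v)"
    by simp_all
  define M where "M = norm (A *v v)"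
  have bound: "norm (A *v w) \<le> M * norm w" for w
  proof (cases "w = 0")
    case False
    then have "norm (A *v (w /\<^sub>R norm w)) \<le> M" unfolding M_def by (intro max) simp
    then show ?thesis using False
      by (simp add: matrix_vector_mult_scaleR field_simps)
  qed simp
  have "(A *v x) \<bullet> y = x \<bullet> (A *v y)" for x y
    by (metis dot_lmul_matrix sym vector_transpose_matrix)
  then have "(A *v (A *v v)) \<bullet> v = M\<^sup>2"
    unfolding M_def by (simp add: power2_norm_eq_inner)
  then have "(norm (A *v (A *v v) - M\<^sup>2 *\<^sub>R v))\<^sup>2 = (norm (A *v (A *v v)))\<^sup>2 - (M * M)\<^sup>2"
    using v dot_square_norm[of v]
    by (simp add: power2_norm_eq_inner inner_diff_left inner_diff_right inner_commute)
       (simp add: power2_eq_square power4_eq_xxxx)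
  also have "\<dots> \<le> 0"
    using power_mono[OF bound[of "A *v v"], of 2] by (simp add: M_def)
  finally have AAv: "A *v (A *v v) = M\<^sup>2 *\<^sub>R v" by simp
  have "M \<le> spectral_radius (map_matrix complex_of_real A)"
  proof (cases "A *v v = (- M) *\<^sub>R v")
    case True
    moreover have "v \<noteq> 0" using v by auto
    ultimately show ?thesis using abs_eigenvalue_le_spectral_radius by fastforce
  next
    case False
    let ?w = "A *v v + M *\<^sub>R v"
    have "A *v ?w = M *\<^sub>R ?w"
      by (simp add: matrix_vector_right_distrib AAv matrix_vector_mult_scaleR
            scaleR_add_right power2_eq_square)
    moreover have "?w \<noteq> 0" using False by (simp add: eq_neg_iff_add_eq_0)
    ultimately show ?thesis using abs_eigenvalue_le_spectral_radius by fastforce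
  qed
  then show ?thesis using bound[of w] by (meson mult_right_mono norm_ge_zero order_trans)
qed

section \<open>Means and disagreements\<close>

lemma transpose_averaging [simp]: "transpose averaging = averaging"
  by (simp add: averaging_def transpose_def)

lemma averaging_idempotent [simp]: "averaging ** averaging = averaging"
  by (simp add: averaging_def matrix_matrix_mult_def vec_eq_iff)

lemma row_sum_one: "W *v 1 = 1 \<Longrightarrow> (\<Sum>j\<in>UNIV. W $ i $ j) = (1::real)"
  by (simp add: vec_eq_iff matrix_vector_mult_def)

lemma
  assumes "W *v 1 = 1" "transpose W = W"
  shows mult_averaging_right: "W ** averaging = averaging"
    and mult_averaging_left: "averaging ** W = averaging"
proof -
  have row: "(\<Sum>j\<in>UNIV. W $ i $ j) = 1" for i by (rule row_sum_one[OF assms(1)])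
  have col: "(\<Sum>i\<in>UNIV. W $ i $ j) = 1" for j
    using row[of j] by (subst (asm) assms(2)[symmetric]) (simp add: transpose_def)
  show "W ** averaging = averaging"
    by (simp add: averaging_def matrix_matrix_mult_def vec_eq_iff flip: sum_divide_distrib)
       (simp add: row)
  show "averaging ** W = averaging"
    by (simp add: averaging_def matrix_matrix_mult_def vec_eq_iff flip: sum_divide_distrib)
       (simp add: col)
qed

text \<open>
  Averaging is an orthogonal projection.
\<close>

lemma averaging_pythagoras:
  fixes x :: "(real^'d::finite)^'n::finite"
  shows "(norm (mix averaging x))\<^sup>2 + (norm (x - mix averaging x))\<^sup>2 = (norm x)\<^sup>2"
proof -
  have "mix averaging x \<bullet> mix averaging x = x \<bullet> mix averaging x"
    by (simp add: inner_mix mix_mix)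
  then show ?thesis
    by (simp add: power2_norm_eq_inner inner_diff_left inner_diff_right inner_commute)
qed

lemma mix_eq_sum_neighbours:
  assumes "(nb, W) \<in> graph_class \<sigma>"
  shows "(\<Sum>j\<in>nb i. W $ i $ j *\<^sub>R v $ j) = mix W v $ i"
proof -
  have "W $ i $ j = 0" if "j \<notin> nb i" for j
    using assms that by (auto simp: graph_class_def)
  then show ?thesis unfolding mix_nth by (intro sum.mono_neutral_left) auto
qed

text \<open>
  On disagreements \<open>W\<close> acts like the symmetric matrix \<open>W - averaging\<close>, whose norm is its spectral
  radius. This is the only way in which the spectrum of \<open>W\<close> enters the convergence proof.
\<close>

lemma graph_class_disagreement:
  fixes v :: "(real^'d::finite)^'n::finite"
  assumes graph: "(nb, W) \<in> graph_class \<sigma>"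
  shows "norm (mix W v - mix averaging (mix W v)) \<le> \<sigma> * norm (v - mix averaging v)"
proof -
  have W: "transpose W = W" "W *v 1 = 1" and \<sigma>: "consensus_norm W \<le> \<sigma>"
    using graph by (auto simp: graph_class_def)
  let ?A = "W - averaging"
  have "transpose ?A = ?A"
    using W(1) by (simp add: transpose_def vec_eq_iff averaging_def)
  then have A: "norm (?A *v w) \<le> consensus_norm W * norm w" for w
    unfolding consensus_norm_def averaging_def[symmetric] by (rule symmetric_norm_le_spectral_radius)
  have "0 \<le> consensus_norm W"
    using order_trans[OF norm_ge_zero A[of "axis undefined 1"]] by simp
  then have "norm (mix ?A (v - mix averaging v)) \<le> consensus_norm W * norm (v - mix averaging v)"
    using A by (intro norm_mix_le)
  also have "\<dots> \<le> \<sigma> * norm (v - mix averaging v)"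
    using \<sigma> by (rule mult_right_mono) simp
  also have "mix ?A (v - mix averaging v) = mix W v - mix averaging (mix W v)"
    using mult_averaging_left[OF W(2,1)] mult_averaging_right[OF W(2,1)]
    unfolding mix_diff_left by (simp add: mix_diff mix_mix)
  finally show ?thesis .
qed

lemma mix_averaging_mix:
  assumes "(nb, W) \<in> graph_class \<sigma>"
  shows "mix averaging (mix W v) = mix averaging v"
  using assms by (simp add: mix_mix mult_averaging_left graph_class_def)

lemma mix_averaging_consensus: "(\<And>i j. v $ i = v $ j) \<Longrightarrow> mix averaging v = v"
  for v :: "('a::real_vector)^'n::finite"
proof -
  assume v: "\<And>i j. v $ i = v $ j"
  have "mix averaging v $ i = v $ i" for i
  proof -
    have "mix averaging v $ i = (\<Sum>j\<in>(UNIV::'n set). (1 / real CARD('n)) *\<^sub>R v $ i)"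
      unfolding mix_nth using v by (intro sum.cong refl) (simp add: averaging_def)
    then show ?thesis by (simp add: sum_constant_scaleR)
  qed
  then show ?thesis by (simp add: vec_eq_iff)
qed

lemma mix_averaging_eq_0: "(\<Sum>j\<in>UNIV. v $ j) = 0 \<Longrightarrow> mix averaging v = 0"
  by (simp add: vec_eq_iff mix_nth averaging_def flip: scaleR_sum_right)

section \<open>Gradients of strongly convex smooth functions\<close>

text \<open>
  Let \<open>d = g y - g x\<close>. The point \<open>y - t d\<close> is bounded below from \<open>x\<close> by convexity and above from \<open>y\<close>
  by smoothness; comparing the two bounds and adding the result for \<open>(x, y)\<close> and \<open>(y, x)\<close> gives
  \<open>2 t |d|\<^sup>2 - \<beta> t\<^sup>2 |d|\<^sup>2 \<le> d \<bullet> (y - x)\<close> for every \<open>t\<close>. The choice \<open>t = 1 / \<beta>\<close> is optimal; for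
  \<open>\<beta> = 0\<close> a large \<open>t\<close> forces \<open>d = 0\<close>.
\<close>

lemma smooth_convex_cocoercive:
  fixes h :: "'a::real_inner \<Rightarrow> real" and g :: "'a \<Rightarrow> 'a"
  assumes convex: "\<And>x y. h x + g x \<bullet> (y - x) \<le> h y"
    and smooth: "\<And>x y. h y \<le> h x + g x \<bullet> (y - x) + \<beta> / 2 * (norm (y - x))\<^sup>2"
    and \<beta>: "0 \<le> \<beta>"
  shows "(norm (g y - g x))\<^sup>2 \<le> \<beta> * ((g y - g x) \<bullet> (y - x))"
proof -
  have half: "t * (norm (g y - g x))\<^sup>2 - \<beta> / 2 * t\<^sup>2 * (norm (g y - g x))\<^sup>2 \<le> h y - h x - g x \<bullet> (y - x)"
    for t x y
  proof -
    define d where "d = g y - g x"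
    have "h x + g x \<bullet> (y - t *\<^sub>R d - x) \<le> h (y - t *\<^sub>R d)" by (rule convex)
    also have "\<dots> \<le> h y + g y \<bullet> (y - t *\<^sub>R d - y) + \<beta> / 2 * (norm (y - t *\<^sub>R d - y))\<^sup>2" by (rule smooth)
    also have "(norm (y - t *\<^sub>R d - y))\<^sup>2 = t\<^sup>2 * (norm d)\<^sup>2" by (simp add: power_mult_distrib)
    also have "y - t *\<^sub>R d - y = - t *\<^sub>R d" by simp
    finally have "t * ((g y - g x) \<bullet> d) - \<beta> / 2 * t\<^sup>2 * (norm d)\<^sup>2 \<le> h y - h x - g x \<bullet> (y - x)"
      by (simp add: inner_diff_right inner_diff_left algebra_simps)
    then show ?thesis by (simp add: d_def power2_norm_eq_inner)
  qed
  have sum: "2 * t * (norm (g y - g x))\<^sup>2 - \<beta> * t\<^sup>2 * (norm (g y - g x))\<^sup>2 \<le> (g y - g x) \<bullet> (y - x)" for t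
    using half[of t y x] half[of t x y]
    by (simp add: norm_minus_commute inner_diff_left inner_diff_right algebra_simps)
  show ?thesis
  proof (cases "\<beta> = 0")
    case False
    with \<beta> have "\<beta> > 0" by simp
    then have "(norm (g y - g x))\<^sup>2 / \<beta> \<le> (g y - g x) \<bullet> (y - x)"
      using sum[of "1 / \<beta>"] by (simp add: power2_eq_square field_simps)
    then show ?thesis using \<open>\<beta> > 0\<close> by (simp add: field_simps)
  next
    case True
    have "norm (g y - g x) = 0"
    proof (rule ccontr)
      assume "norm (g y - g x) \<noteq> 0"
      then show False
        using sum[of "((g y - g x) \<bullet> (y - x) + 1) / (norm (g y - g x))\<^sup>2"]
          sum[of 0] True by simp
    qed
    then show ?thesis using True by simp
  qed
qed

text \<open>
  The gradient increment lies in the ball whose diameter is the segment from \<open>\<mu> (y - x)\<close> to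
  \<open>L (y - x)\<close>. This is cocoercivity of the gradient of \<open>f i - \<mu> / 2 |x|\<^sup>2\<close>, which is convex and
  \<open>(L - \<mu>)\<close>-smooth.
\<close>

lemma gradient_sector:
  fixes f :: "'n::finite \<Rightarrow> real^'d::finite \<Rightarrow> real"
  assumes f: "f \<in> strongly_convex_smooth \<mu> L" and \<mu>L: "\<mu> \<le> L"
  shows "norm (gradient (f i) y - gradient (f i) x - ((L + \<mu>) / 2) *\<^sub>R (y - x))
      \<le> (L - \<mu>) / 2 * norm (y - x)"
proof -
  define h where "h x = f i x - \<mu> / 2 * (norm x)\<^sup>2" for x
  define g where "g x = gradient (f i) x - \<mu> *\<^sub>R x" for x
  have expand: "\<mu> / 2 * (norm y)\<^sup>2 = \<mu> / 2 * (norm x)\<^sup>2 + (\<mu> *\<^sub>R x) \<bullet> (y - x) + \<mu> / 2 * (norm (y - x))\<^sup>2" for x y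
  proof -
    have "(norm y)\<^sup>2 = (norm x)\<^sup>2 + 2 * (x \<bullet> (y - x)) + (norm (y - x))\<^sup>2"
      by (simp add: power2_norm_eq_inner inner_diff_left inner_diff_right inner_commute)
    then show ?thesis by (simp add: distrib_left)
  qed
  have fi: "f i x + gradient (f i) x \<bullet> (y - x) + \<mu> / 2 * (norm (y - x))\<^sup>2 \<le> f i y"
    "f i y \<le> f i x + gradient (f i) x \<bullet> (y - x) + L / 2 * (norm (y - x))\<^sup>2" for x y
    using f by (auto simp: strongly_convex_smooth_def)
  have "h x + g x \<bullet> (y - x) \<le> h y" for x y
    using fi(1)[of x y] expand[of y x] unfolding h_def g_def inner_diff_left by linarith
  moreover have "h y \<le> h x + g x \<bullet> (y - x) + (L - \<mu>) / 2 * (norm (y - x))\<^sup>2" for x y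
    using fi(2)[of y x] expand[of y x]
    unfolding h_def g_def inner_diff_left diff_divide_distrib left_diff_distrib by linarith
  ultimately have coco: "(norm (g y - g x))\<^sup>2 \<le> (L - \<mu>) * ((g y - g x) \<bullet> (y - x))"
    using \<mu>L by (intro smooth_convex_cocoercive[where h = h]) auto
  have eq: "gradient (f i) y - gradient (f i) x - ((L + \<mu>) / 2) *\<^sub>R (y - x)
      = (g y - g x) - ((L - \<mu>) / 2) *\<^sub>R (y - x)"
  proof -
    have "((L + \<mu>) / 2) *\<^sub>R (y - x) = \<mu> *\<^sub>R (y - x) + ((L - \<mu>) / 2) *\<^sub>R (y - x)"
      unfolding scaleR_add_left[symmetric] by (simp add: field_simps)
    then show ?thesis by (simp add: g_def scaleR_diff_right)
  qed
  have "(norm (v - c *\<^sub>R w))\<^sup>2 = (norm v)\<^sup>2 - 2 * c * (v \<bullet> w) + (c * norm w)\<^sup>2"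
    for c and v w :: "real^'d"
  proof -
    have "(norm (v - c *\<^sub>R w))\<^sup>2 = (norm v)\<^sup>2 - 2 * (v \<bullet> (c *\<^sub>R w)) + (norm (c *\<^sub>R w))\<^sup>2"
      unfolding power2_norm_eq_inner inner_diff_left inner_diff_right
      using inner_commute[of "c *\<^sub>R w" v] by linarith
    then show ?thesis by (simp add: power_mult_distrib)
  qed
  from this[of "g y - g x" "(L - \<mu>) / 2" "y - x"]
  have "(norm ((g y - g x) - ((L - \<mu>) / 2) *\<^sub>R (y - x)))\<^sup>2
      = (norm (g y - g x))\<^sup>2 - (L - \<mu>) * ((g y - g x) \<bullet> (y - x)) + ((L - \<mu>) / 2 * norm (y - x))\<^sup>2"
    by simp
  then have "(norm ((g y - g x) - ((L - \<mu>) / 2) *\<^sub>R (y - x)))\<^sup>2 \<le> ((L - \<mu>) / 2 * norm (y - x))\<^sup>2"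
    using coco by linarith
  then show ?thesis
    unfolding eq by (rule power2_le_imp_le) (use \<mu>L in simp)
qed

text \<open>
  The point chosen by \<open>ARG_MIN\<close> is a critical point once a minimizer exists. Strong convexity
  makes the sum \<open>F\<close> of the objectives at least \<open>F 0\<close> outside a ball, so a minimizer over that
  ball is global.
\<close>

lemma
  fixes f :: "'n::finite \<Rightarrow> real^'d::finite \<Rightarrow> real"
  assumes f: "f \<in> strongly_convex_smooth \<mu> L" and \<mu>: "0 < \<mu>"
  shows consensus_optimum_eq: "consensus_optimum f $ i = consensus_optimum f $ j"
    and sum_gradient_consensus_optimum: "(\<Sum>j\<in>UNIV. gradient (f j) (consensus_optimum f $ j)) = 0"
proof -
  define F where "F z = (\<Sum>j\<in>UNIV. f j z)" for z
  define G where "G z = (\<Sum>j\<in>UNIV. gradient (f j) z)" for z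
  define N where "N = real CARD('n)"
  have N: "N > 0" by (simp add: N_def)
  have lower: "F x + G x \<bullet> (y - x) + N * \<mu> / 2 * (norm (y - x))\<^sup>2 \<le> F y" for x y
  proof -
    have "(\<Sum>j\<in>UNIV. f j x + gradient (f j) x \<bullet> (y - x) + \<mu> / 2 * (norm (y - x))\<^sup>2) \<le> F y"
      unfolding F_def using f by (intro sum_mono) (auto simp: strongly_convex_smooth_def)
    then show ?thesis by (simp add: F_def G_def N_def sum.distrib inner_sum_left)
  qed
  have der: "(F has_derivative (\<lambda>h. h \<bullet> G x)) (at x)" for x
  proof -
    have "(f j has_derivative (\<lambda>h. h \<bullet> gradient (f j) x)) (at x)" for j
      using f GDERIV_gradient[of "f j" x] by (auto simp: strongly_convex_smooth_def gderiv_def)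
    then show ?thesis
      unfolding F_def G_def inner_sum_right by (rule has_derivative_sum)
  qed
  have cont: "continuous_on S F" for S
    by (meson continuous_at_imp_continuous_on der has_derivative_continuous)
  define R where "R = 2 * norm (G 0) / (N * \<mu>)"
  have R: "0 \<le> R" using N \<mu> by (simp add: R_def)
  have "\<exists>z\<in>cball 0 R. \<forall>y\<in>cball 0 R. F z \<le> F y"
    using R cont by (intro continuous_attains_inf) auto
  then obtain z where z: "\<And>y. y \<in> cball 0 R \<Longrightarrow> F z \<le> F y" by blast
  have min: "F z \<le> F y" for y
  proof (cases "norm y \<le> R")
    case False
    then have "2 * norm (G 0) \<le> N * \<mu> * norm y" using N \<mu> by (simp add: R_def field_simps)
    then have "2 * norm (G 0) * norm y \<le> N * \<mu> * norm y * norm y" by (rule mult_right_mono) simp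
    moreover have "- (norm (G 0) * norm y) \<le> G 0 \<bullet> y"
      using Cauchy_Schwarz_ineq2[of "G 0" y] by linarith
    ultimately have "F 0 \<le> F y" using lower[of 0 y] by (simp add: power2_eq_square)
    then show ?thesis using z[of 0] R by simp
  qed (use z in simp)
  define x where "x = (ARG_MIN F z. True)"
  have "is_arg_min F (\<lambda>_. True) z" using min by (simp add: is_arg_min_linorder)
  then have "is_arg_min F (\<lambda>_. True) x"
    unfolding x_def arg_min_def by (rule someI)
  then have min_x: "F x \<le> F y" for y by (simp add: is_arg_min_linorder)
  have "(\<lambda>h. h \<bullet> G x) = (\<lambda>h. 0)"
    using der[of x] min_x by (intro differential_zero_maxmin[of x UNIV F]) auto
  then have "G x \<bullet> G x = 0" by meson
  then have "G x = 0" by simp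
  moreover have "consensus_optimum f $ i = x" for i
    by (simp add: consensus_optimum_def x_def F_def[abs_def])
  ultimately show "consensus_optimum f $ i = consensus_optimum f $ j"
    and "(\<Sum>j\<in>UNIV. gradient (f j) (consensus_optimum f $ j)) = 0"
    by (simp_all add: G_def)
qed

text \<open>
  Quadratics with a common curvature and different centres; the centres give control over the
  initial gradients, and thereby over \<open>y 0\<close>.
\<close>

lemma shifted_square:
  fixes c :: "'n::finite \<Rightarrow> real^'d::finite" and m :: real
  defines "f \<equiv> (\<lambda>i z. m / 2 * (norm (z - c i))\<^sup>2)"
  shows gradient_shifted_square: "gradient (f i) x = m *\<^sub>R (x - c i)"
    and shifted_square_strongly_convex_smooth:
      "\<mu> \<le> m \<Longrightarrow> m \<le> L \<Longrightarrow> f \<in> strongly_convex_smooth \<mu> L"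
proof -
  have G: "GDERIV (f i) x :> m *\<^sub>R (x - c i)" for i x
    unfolding f_def gderiv_def power2_norm_eq_inner
    by (auto intro!: derivative_eq_intros simp: inner_commute)
  show grad: "gradient (f i) x = m *\<^sub>R (x - c i)" for i x
    using G by (rule gradient_eqI)
  have expand: "f i y = f i x + gradient (f i) x \<bullet> (y - x) + m / 2 * (norm (y - x))\<^sup>2" for i x y
    unfolding grad unfolding f_def power2_norm_eq_inner
    by (simp add: inner_diff_left inner_diff_right inner_commute algebra_simps)
  assume m: "\<mu> \<le> m" "m \<le> L"
  show "f \<in> strongly_convex_smooth \<mu> L"
    unfolding strongly_convex_smooth_def
  proof (intro CollectI allI conjI)
    show "f i differentiable at x" for i x
      using G by (auto simp: gderiv_def differentiable_def)
    show "f i x + gradient (f i) x \<bullet> (y - x) + \<mu> / 2 * (norm (y - x))\<^sup>2 \<le> f i y" for i x y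
      unfolding expand[of i y x] using m by (simp add: mult_right_mono)
    show "f i y \<le> f i x + gradient (f i) x \<bullet> (y - x) + L / 2 * (norm (y - x))\<^sup>2" for i x y
      unfolding expand[of i y x] using m by (simp add: mult_right_mono)
  qed
qed

section \<open>Weighted norms of sequences\<close>

text \<open>
  The \<open>\<ell>\<^sup>2\<close> norm of \<open>s k / r\<^sup>k\<close>, truncated to \<open>k < K\<close> so that it is finite for every sequence. All
  bounds below are uniform in \<open>K\<close>.
\<close>

definition wnorm :: "real \<Rightarrow> nat \<Rightarrow> (nat \<Rightarrow> 'a::real_normed_vector) \<Rightarrow> real" where
  "wnorm r K s = L2_set (\<lambda>k. norm (s k) / r ^ k) {..<K}"

lemma wnorm_nonneg [simp]: "0 \<le> wnorm r K s"
  by (simp add: wnorm_def)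

lemma wnorm_square: "(wnorm r K s)\<^sup>2 = (\<Sum>k<K. (norm (s k))\<^sup>2 / (r ^ k)\<^sup>2)"
  by (simp add: wnorm_def L2_set_def sum_nonneg power_divide)

lemma wnorm_triangle:
  assumes r: "0 < r" and le: "\<And>k. norm (s k) \<le> p * norm (t k) + q * norm (u k)" and pq: "0 \<le> p" "0 \<le> q"
  shows "wnorm r K s \<le> p * wnorm r K t + q * wnorm r K u"
proof -
  have "wnorm r K s \<le> L2_set (\<lambda>k. p * (norm (t k) / r ^ k) + q * (norm (u k) / r ^ k)) {..<K}"
    unfolding wnorm_def using r le
    by (intro L2_set_mono) (simp_all add: divide_right_mono flip: add_divide_distrib)
  also have "\<dots> \<le> L2_set (\<lambda>k. p * (norm (t k) / r ^ k)) {..<K} + L2_set (\<lambda>k. q * (norm (u k) / r ^ k)) {..<K}"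
    by (rule L2_set_triangle_ineq)
  finally show ?thesis using pq by (simp add: wnorm_def L2_set_right_distrib)
qed

lemma wnorm_Suc_square:
  assumes "0 < r"
  shows "(r * wnorm r (Suc K) s)\<^sup>2 = (r * norm (s 0))\<^sup>2 + (wnorm r K (\<lambda>k. s (Suc k)))\<^sup>2"
proof -
  have "r\<^sup>2 * ((norm (s (Suc k)))\<^sup>2 / (r ^ Suc k)\<^sup>2) = (norm (s (Suc k)))\<^sup>2 / (r ^ k)\<^sup>2" for k
    using assms by (simp add: power_mult_distrib)
  then show ?thesis
    unfolding power_mult_distrib wnorm_square sum.lessThan_Suc_shift
    by (simp add: distrib_left sum_distrib_left)
qed

lemma wnorm_shift_le:
  assumes "0 < r"
  shows "wnorm r K (\<lambda>k. s (Suc k)) \<le> r * wnorm r (Suc K) s"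
  by (rule power2_le_imp_le) (use assms in \<open>simp_all add: wnorm_Suc_square\<close>)

lemma wnorm_le_shift:
  assumes "0 < r"
  shows "r * wnorm r (Suc K) s \<le> r * norm (s 0) + wnorm r K (\<lambda>k. s (Suc k))"
proof -
  have "r * wnorm r (Suc K) s = sqrt ((r * wnorm r (Suc K) s)\<^sup>2)" using assms by simp
  also have "\<dots> \<le> r * norm (s 0) + wnorm r K (\<lambda>k. s (Suc k))"
    unfolding wnorm_Suc_square[OF assms] using assms by (intro sqrt_sum_squares_le_sum) auto
  finally show ?thesis .
qed

lemma wnorm_le_Suc: "wnorm r K s \<le> wnorm r (Suc K) s"
  by (rule power2_le_imp_le) (simp_all add: wnorm_square)

text \<open>
  Shifting a sequence multiplies its norm by \<open>r\<close>, apart from the initial term. Hence a recursion with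
  factor \<open>p < r\<close> amplifies its input by at most \<open>1 / (r - p)\<close>. The input is truncated one step
  earlier than the output, which reflects that the recursion is causal.
\<close>

lemma wnorm_first_order:
  assumes r: "0 < r" and pq: "0 \<le> p" "0 \<le> q"
    and step: "\<And>k. norm (s (Suc k)) \<le> p * norm (s k) + q * norm (t k)"
  shows "(r - p) * wnorm r (Suc K) s \<le> r * norm (s 0) + q * wnorm r K t"
proof -
  have "r * wnorm r (Suc K) s \<le> r * norm (s 0) + (p * wnorm r K s + q * wnorm r K t)"
    using wnorm_le_shift[OF r, of K s]
      wnorm_triangle[where s = "\<lambda>k. s (Suc k)" and K = K, OF r step pq] by linarith
  moreover have "p * wnorm r K s \<le> p * wnorm r (Suc K) s"
    using pq wnorm_le_Suc by (intro mult_left_mono)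
  ultimately show ?thesis by (simp add: algebra_simps)
qed

lemma wnorm_difference_le:
  assumes "0 < r"
  shows "wnorm r K (\<lambda>k. s (Suc k) - s k) \<le> (1 + r) * wnorm r (Suc K) s"
proof -
  have "wnorm r K (\<lambda>k. s (Suc k) - s k) \<le> 1 * wnorm r K (\<lambda>k. s (Suc k)) + 1 * wnorm r K s"
    using assms by (rule wnorm_triangle) (simp_all add: norm_triangle_ineq4)
  then show ?thesis
    using wnorm_shift_le[OF assms, of K s] wnorm_le_Suc[of r K s] by (simp add: algebra_simps)
qed

text \<open>
  The squares of \<open>|s k| / r\<^sup>k\<close> have bounded partial sums, so they are summable and tend to 0.
\<close>

lemma wnorm_bounded_imp_tendsto_0:
  assumes r: "0 < r" and bd: "\<And>K. wnorm r (Suc K) s \<le> M"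
  shows "(\<lambda>k. r powi (- int k) *\<^sub>R s k) \<longlonglongrightarrow> 0"
proof -
  have "0 \<le> M" using bd[of 0] wnorm_nonneg order_trans by blast
  have *: "(norm (r powi (- int k) *\<^sub>R s k))\<^sup>2 = (norm (s k))\<^sup>2 / (r ^ k)\<^sup>2" for k
    using r by (simp add: power_int_minus power_mult_distrib divide_inverse power_inverse)
  have "(\<Sum>k<n. (norm (s k))\<^sup>2 / (r ^ k)\<^sup>2) \<le> M\<^sup>2" for n
    using power_mono[OF order_trans[OF wnorm_le_Suc bd] wnorm_nonneg, of n 2] by (simp flip: wnorm_square)
  then have "summable (\<lambda>k. (norm (s k))\<^sup>2 / (r ^ k)\<^sup>2)"
    by (intro bounded_imp_summable[of _ "M\<^sup>2"]) (simp_all only: lessThan_Suc_atMost[symmetric], simp)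
  then have "(\<lambda>k. (norm (r powi (- int k) *\<^sub>R s k))\<^sup>2) \<longlonglongrightarrow> 0"
    unfolding * by (rule summable_LIMSEQ_zero)
  then have "(\<lambda>k. sqrt ((norm (r powi (- int k) *\<^sub>R s k))\<^sup>2)) \<longlonglongrightarrow> sqrt 0"
    by (rule tendsto_real_sqrt)
  then show ?thesis by (simp add: tendsto_norm_zero_iff del: norm_scaleR)
qed

text \<open>
  A pointwise inequality between sums of squares carries over to the weighted norms.
\<close>

lemma wnorm_pythagoras_le:
  assumes r: "0 < r" and d: "0 \<le> d"
    and le: "\<And>k. (norm (p k))\<^sup>2 + (norm (q k))\<^sup>2 \<le> d\<^sup>2 * ((norm (s k))\<^sup>2 + (norm (t k))\<^sup>2)"
  shows "(wnorm r K p)\<^sup>2 + (wnorm r K q)\<^sup>2 \<le> d\<^sup>2 * ((wnorm r K s)\<^sup>2 + (wnorm r K t)\<^sup>2)"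
proof -
  have "(norm (p k))\<^sup>2 / (r ^ k)\<^sup>2 + (norm (q k))\<^sup>2 / (r ^ k)\<^sup>2
      \<le> d\<^sup>2 * ((norm (s k))\<^sup>2 / (r ^ k)\<^sup>2 + (norm (t k))\<^sup>2 / (r ^ k)\<^sup>2)" for k
    using divide_right_mono[OF le[of k], of "(r ^ k)\<^sup>2"] by (simp add: add_divide_distrib distrib_left)
  then show ?thesis
    unfolding wnorm_square sum.distrib[symmetric] sum_distrib_left by (intro sum_mono) 
qed

text \<open>
  By the triangle inequality in the plane, \<open>\<delta>' |(a, b)| \<le> |(p, q)| + |(c, c)| \<le> \<delta> |(a, b)| + |(c, c)|\<close>.
  In the application \<open>a\<close>, \<open>b\<close> measure the error of the mean and the disagreement, and \<open>p\<close>, \<open>q\<close> the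
  corresponding parts of the nonlinear remainder of the gradients.
\<close>

lemma small_gain:
  fixes a b p q :: real
  assumes \<delta>: "0 \<le> \<delta>" "\<delta> < \<delta>'" and nn: "0 \<le> a" "0 \<le> b" "0 \<le> c"
    and a: "\<delta>' * a \<le> p + c" and b: "\<delta>' * b \<le> q + c"
    and pq: "p\<^sup>2 + q\<^sup>2 \<le> \<delta>\<^sup>2 * (a\<^sup>2 + b\<^sup>2)"
  shows "sqrt (a\<^sup>2 + b\<^sup>2) \<le> sqrt 2 * c / (\<delta>' - \<delta>)"
proof -
  have "\<delta>' * sqrt (a\<^sup>2 + b\<^sup>2) = sqrt ((\<delta>' * a)\<^sup>2 + (\<delta>' * b)\<^sup>2)"
    using \<delta> by (simp add: power_mult_distrib real_sqrt_mult flip: distrib_left)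
  also have "\<dots> \<le> sqrt ((p + c)\<^sup>2 + (q + c)\<^sup>2)"
    using a b \<delta> nn by (intro real_sqrt_le_mono add_mono power_mono) auto
  also have "\<dots> \<le> sqrt (p\<^sup>2 + q\<^sup>2) + sqrt (c\<^sup>2 + c\<^sup>2)"
    by (rule real_sqrt_sum_squares_triangle_ineq)
  also have "sqrt (p\<^sup>2 + q\<^sup>2) \<le> \<delta> * sqrt (a\<^sup>2 + b\<^sup>2)"
    using real_sqrt_le_mono[OF pq] \<delta> by (simp add: real_sqrt_mult)
  also have "sqrt (c\<^sup>2 + c\<^sup>2) = sqrt 2 * c"
    using nn by (simp add: real_sqrt_mult flip: mult_2)
  finally show ?thesis using \<delta> by (simp add: field_simps)
qed

section \<open>Convergence\<close>

definition stacked_gradient :: "('n::finite \<Rightarrow> real^'d::finite \<Rightarrow> real) \<Rightarrow> (real^'d)^'n \<Rightarrow> (real^'d)^'n" where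
  "stacked_gradient f x = (\<chi> i. gradient (f i) (x $ i))"

lemma AugDGM_stacked:
  assumes graph: "(nb, W) \<in> graph_class \<sigma>"
  shows "AugDGM nb W f \<alpha> x y \<longleftrightarrow>
     y 0 = stacked_gradient f (x 0) \<and>
     (\<forall>k. x (Suc k) = mix W (x k - \<alpha> *\<^sub>R y k)) \<and>
     (\<forall>k. y (Suc k) = mix W (y k + stacked_gradient f (x (Suc k)) - stacked_gradient f (x k)))"
proof -
  have 1: "(\<Sum>j\<in>nb i. W $ i $ j *\<^sub>R (x k $ j - \<alpha> *\<^sub>R y k $ j)) = mix W (x k - \<alpha> *\<^sub>R y k) $ i" for k i
    by (simp flip: mix_eq_sum_neighbours[OF graph])
  have 2: "(\<Sum>j\<in>nb i. W $ i $ j *\<^sub>R (y k $ j + gradient (f j) (x (Suc k) $ j) - gradient (f j) (x k $ j)))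
     = mix W (y k + stacked_gradient f (x (Suc k)) - stacked_gradient f (x k)) $ i" for k i
    by (simp add: stacked_gradient_def flip: mix_eq_sum_neighbours[OF graph])
  show ?thesis
    unfolding AugDGM_def 1 2 by (auto simp: vec_eq_iff stacked_gradient_def)
qed

text \<open>
  The two conditions on \<open>r\<close> say that the loop gain is less than 1 for the mean and for the
  disagreement. The parts \<open>J\<close> and \<open>P\<close> share one sector bound \<open>\<delta>\<close>, since the gradients couple them; the
  final step therefore adds the two squared estimates instead of treating the parts one by one.
\<close>

lemma AugDGM_converges:
  fixes f :: "'n::finite \<Rightarrow> real^'d::finite \<Rightarrow> real"
  assumes \<mu>: "0 < \<mu>" "\<mu> \<le> L" and \<sigma>: "0 \<le> \<sigma>" and \<alpha>: "0 < \<alpha>"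
    and f: "f \<in> strongly_convex_smooth \<mu> L" and graph: "(nb, W) \<in> graph_class \<sigma>"
    and run: "AugDGM nb W f \<alpha> x y"
    and avg: "\<bar>1 - \<alpha> * ((L + \<mu>) / 2)\<bar> + \<alpha> * ((L - \<mu>) / 2) < r"
    and dis: "\<sigma> < r" "\<alpha> * \<sigma>\<^sup>2 * (1 + r) * L < (r - \<sigma>)\<^sup>2"
  shows "(\<lambda>k. r powi (- int k) *\<^sub>R (x k - consensus_optimum f)) \<longlonglongrightarrow> 0"
proof -
  define J :: "(real^'d)^'n \<Rightarrow> (real^'d)^'n" where "J = mix averaging"
  have J_simps: "J (u + v) = J u + J v" "J (u - v) = J u - J v" "J (c *\<^sub>R u) = c *\<^sub>R J u" "J (mix W u) = J u"
    for u v c by (simp_all add: J_def mix_add mix_diff mix_scaleR mix_averaging_mix[OF graph])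
  define X where "X = consensus_optimum f"
  define g where "g k = stacked_gradient f (x k)" for k
  define e where "e k = x k - X" for k
  define h where "h k = g k - stacked_gradient f X" for k
  define m where "m = (L + \<mu>) / 2"
  define \<delta> where "\<delta> = (L - \<mu>) / 2"
  have m: "0 < m" and \<delta>: "0 \<le> \<delta>" and L: "0 < L" and r: "0 < r"
    using \<mu> \<sigma> dis by (auto simp: m_def \<delta>_def)
  have y0: "y 0 = g 0"
    and x_Suc: "x (Suc k) = mix W (x k - \<alpha> *\<^sub>R y k)"
    and y_Suc: "y (Suc k) = mix W (y k + g (Suc k) - g k)" for k
    using run unfolding AugDGM_stacked[OF graph] by (auto simp: g_def)
  have JX: "J X = X"
    unfolding J_def X_def using consensus_optimum_eq[OF f \<mu>(1)] by (rule mix_averaging_consensus)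
  have JgX: "J (stacked_gradient f X) = 0"
    unfolding J_def using sum_gradient_consensus_optimum[OF f \<mu>(1)]
    by (intro mix_averaging_eq_0) (simp add: stacked_gradient_def X_def)

  \<comment> \<open>\<open>J\<close> and \<open>P\<close> extract the mean and the disagreement.\<close>
  define P where "P v = v - J v" for v
  have P_simps: "P (u + v) = P u + P v" "P (u - v) = P u - P v" "P (c *\<^sub>R u) = c *\<^sub>R P u" for u v c
    by (simp_all add: P_def J_simps algebra_simps)
  have P_mix: "norm (P (mix W v)) \<le> \<sigma> * norm (P v)" for v
    unfolding P_def J_def by (rule graph_class_disagreement[OF graph])
  have Pe: "P (e k) = P (x k)" for k by (simp add: e_def P_def J_simps JX)
  have Ph: "P (h (Suc k)) - P (h k) = P (g (Suc k)) - P (g k)" for k by (simp add: h_def P_simps)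

  have disagreement_x: "norm (P (e (Suc k))) \<le> \<sigma> * norm (P (e k)) + \<sigma> * \<alpha> * norm (P (y k))" for k
  proof -
    have "norm (P (e (Suc k))) \<le> \<sigma> * norm (P (e k) - \<alpha> *\<^sub>R P (y k))"
      unfolding Pe x_Suc by (rule order_trans[OF P_mix]) (simp add: P_simps)
    also have "\<dots> \<le> \<sigma> * (norm (P (e k)) + \<alpha> * norm (P (y k)))"
      using \<sigma> \<alpha> norm_triangle_ineq4[of "P (e k)" "\<alpha> *\<^sub>R P (y k)"] by (intro mult_left_mono) auto
    finally show ?thesis by (simp add: algebra_simps)
  qed
  have disagreement_y:
    "norm (P (y (Suc k))) \<le> \<sigma> * norm (P (y k)) + \<sigma> * norm (P (h (Suc k)) - P (h k))" for k
  proof -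
    have "norm (P (y (Suc k))) \<le> \<sigma> * norm (P (y k) + (P (h (Suc k)) - P (h k)))"
      unfolding Ph y_Suc by (rule order_trans[OF P_mix]) (simp add: P_simps add_diff_eq)
    also have "\<dots> \<le> \<sigma> * (norm (P (y k)) + norm (P (h (Suc k)) - P (h k)))"
      using \<sigma> by (intro mult_left_mono norm_triangle_ineq)
    finally show ?thesis by (simp add: algebra_simps)
  qed

  \<comment> \<open>Gradient tracking: the initialization \<open>y 0 = g 0\<close> is preserved on average.\<close>
  have tracking: "J (y k) = J (h k)" for k
  proof -
    have "J (y k) = J (g k)"
      by (induction k) (simp_all add: y0 y_Suc J_simps)
    then show ?thesis by (simp add: h_def J_simps JgX)
  qed
  have average: "norm (J (e (Suc k))) \<le> \<bar>1 - \<alpha> * m\<bar> * norm (J (e k)) + \<alpha> * norm (J (h k - m *\<^sub>R e k))" for k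
  proof -
    have "J (e (Suc k)) = J (e k) - \<alpha> *\<^sub>R J (h k)"
      by (simp add: e_def x_Suc J_simps JX tracking)
    also have "\<dots> = (1 - \<alpha> * m) *\<^sub>R J (e k) - \<alpha> *\<^sub>R J (h k - m *\<^sub>R e k)"
      by (simp add: J_simps algebra_simps)
    finally show ?thesis
      using norm_triangle_ineq4[of "(1 - \<alpha> * m) *\<^sub>R J (e k)" "\<alpha> *\<^sub>R J (h k - m *\<^sub>R e k)"] \<alpha> by simp
  qed

  have pythagoras: "(norm (J v))\<^sup>2 + (norm (P v))\<^sup>2 = (norm v)\<^sup>2" for v
    unfolding J_def P_def by (rule averaging_pythagoras)
  have sector: "(norm (J (h k - m *\<^sub>R e k)))\<^sup>2 + (norm (P (h k - m *\<^sub>R e k)))\<^sup>2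
      \<le> \<delta>\<^sup>2 * ((norm (J (e k)))\<^sup>2 + (norm (P (e k)))\<^sup>2)" for k
  proof -
    have "norm ((h k - m *\<^sub>R e k) $ i) \<le> \<delta> * norm (e k $ i)" for i
      using gradient_sector[OF f \<mu>(2), of i "x k $ i" "X $ i"]
      by (simp add: h_def g_def e_def m_def \<delta>_def stacked_gradient_def)
    then have "(\<Sum>i\<in>UNIV. (norm ((h k - m *\<^sub>R e k) $ i))\<^sup>2) \<le> (\<Sum>i\<in>UNIV. (\<delta> * norm (e k $ i))\<^sup>2)"
      by (intro sum_mono power_mono) auto
    then show ?thesis
      unfolding pythagoras norm_vec_square[of "h k - m *\<^sub>R e k"] norm_vec_square[of "e k"]
      by (simp add: power_mult_distrib sum_distrib_left)
  qed

  have "\<alpha> * \<sigma>\<^sup>2 * (1 + r) < (r - \<sigma>)\<^sup>2 / L" using dis L by (simp add: field_simps)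
  \<comment> \<open>A strictly positive upper bound for the gain also covers \<open>\<sigma> = 0\<close>, where the gain itself vanishes.\<close>
  then obtain \<kappa> where \<kappa>: "\<alpha> * \<sigma>\<^sup>2 * (1 + r) < \<kappa>" "\<kappa> < (r - \<sigma>)\<^sup>2 / L"
    using dense by blast
  have "0 \<le> \<alpha> * \<sigma>\<^sup>2 * (1 + r)" using \<alpha> r by simp
  then have \<kappa>_pos: "0 < \<kappa>" using \<kappa>(1) by linarith

  define \<delta>1 where "\<delta>1 = (r - \<sigma>)\<^sup>2 / \<kappa> - m"
  define \<delta>2 where "\<delta>2 = (r - \<bar>1 - \<alpha> * m\<bar>) / \<alpha>"
  define c1 where "c1 = ((r - \<sigma>) * (r * norm (P (e 0))) + \<sigma> * \<alpha> * (r * norm (P (y 0)))) / \<kappa>"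
  define c2 where "c2 = r * norm (J (e 0)) / \<alpha>"
  have "L < (r - \<sigma>)\<^sup>2 / \<kappa>" using \<kappa>(2) \<kappa>_pos L by (simp add: field_simps)
  then have \<delta>1: "\<delta> < \<delta>1" by (simp add: \<delta>1_def \<delta>_def m_def field_simps)
  have "\<alpha> * \<delta> < r - \<bar>1 - \<alpha> * m\<bar>" using avg by (simp add: m_def \<delta>_def)
  then have \<delta>2: "\<delta> < \<delta>2" using \<alpha> by (simp add: \<delta>2_def field_simps)
  have c: "0 \<le> c1" "0 \<le> c2" using \<alpha> \<kappa>_pos r \<sigma> dis by (simp_all add: c1_def c2_def)

  define w where "w s K = wnorm r (Suc K) s" for s :: "nat \<Rightarrow> (real^'d)^'n" and K
  have w_nonneg [simp]: "0 \<le> w s K" for s K by (simp add: w_def)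
  \<comment> \<open>Compose the recursions for \<open>y\<close> and \<open>x\<close>: each has gain \<open>\<sigma> / (r - \<sigma>)\<close>, the step size
      contributes \<open>\<alpha>\<close> and the difference of gradients \<open>1 + r\<close>. So, apart from initial values,
      \<open>|P e|\<close> is at most \<open>\<kappa> / (r - \<sigma>)\<^sup>2\<close> times \<open>|P h|\<close>.\<close>
  have gain1: "\<delta>1 * w (\<lambda>k. P (e k)) K \<le> w (\<lambda>k. P (h k - m *\<^sub>R e k)) K + c1" for K
  proof -
    let ?x = "w (\<lambda>k. P (e k)) K" and ?y = "w (\<lambda>k. P (y k)) K" and ?h = "w (\<lambda>k. P (h k)) K"
      and ?B = "w (\<lambda>k. P (h k - m *\<^sub>R e k)) K"
    have "(r - \<sigma>) * ?x \<le> r * norm (P (e 0)) + \<sigma> * \<alpha> * wnorm r K (\<lambda>k. P (y k))"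
      unfolding w_def using r \<sigma> \<alpha> by (intro wnorm_first_order disagreement_x) auto
    also have "\<dots> \<le> r * norm (P (e 0)) + \<sigma> * \<alpha> * ?y"
      unfolding w_def using \<sigma> \<alpha> by (intro add_left_mono mult_left_mono wnorm_le_Suc) auto
    finally have x: "(r - \<sigma>) * ?x \<le> r * norm (P (e 0)) + \<sigma> * \<alpha> * ?y" .
    have "(r - \<sigma>) * ?y \<le> r * norm (P (y 0)) + \<sigma> * wnorm r K (\<lambda>k. P (h (Suc k)) - P (h k))"
      unfolding w_def using r \<sigma> by (intro wnorm_first_order disagreement_y) auto
    also have "\<dots> \<le> r * norm (P (y 0)) + \<sigma> * ((1 + r) * ?h)"
      unfolding w_def using \<sigma> r by (intro add_left_mono mult_left_mono wnorm_difference_le) auto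
    finally have y: "(r - \<sigma>) * ?y \<le> r * norm (P (y 0)) + \<sigma> * ((1 + r) * ?h)" .
    have "norm (P (h k)) \<le> 1 * norm (P (h k - m *\<^sub>R e k)) + m * norm (P (e k))" for k
      using norm_triangle_ineq[of "P (h k - m *\<^sub>R e k)" "P (m *\<^sub>R e k)"] m by (simp add: P_simps)
    then have h: "?h \<le> 1 * ?B + m * ?x"
      unfolding w_def using r m by (intro wnorm_triangle) auto
    have \<kappa>c1: "\<kappa> * c1 = (r - \<sigma>) * (r * norm (P (e 0))) + \<sigma> * \<alpha> * (r * norm (P (y 0)))"
      using \<kappa>_pos by (simp add: c1_def)
    have "(r - \<sigma>)\<^sup>2 * ?x = (r - \<sigma>) * ((r - \<sigma>) * ?x)" by (simp add: power2_eq_square)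
    also have "\<dots> \<le> (r - \<sigma>) * (r * norm (P (e 0)) + \<sigma> * \<alpha> * ?y)"
      using x dis by (intro mult_left_mono) auto
    also have "\<dots> = (r - \<sigma>) * (r * norm (P (e 0))) + \<sigma> * \<alpha> * ((r - \<sigma>) * ?y)"
      by (simp add: algebra_simps)
    also have "\<dots> \<le> (r - \<sigma>) * (r * norm (P (e 0))) + \<sigma> * \<alpha> * (r * norm (P (y 0)) + \<sigma> * ((1 + r) * ?h))"
      using y \<sigma> \<alpha> by (intro add_left_mono mult_left_mono) auto
    also have "\<dots> = \<kappa> * c1 + \<alpha> * \<sigma>\<^sup>2 * (1 + r) * ?h"
      unfolding \<kappa>c1 by (simp add: algebra_simps power2_eq_square)
    also have "\<dots> \<le> \<kappa> * c1 + \<kappa> * ?h"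
      using \<kappa>(1) by (intro add_left_mono mult_right_mono) auto
    also have "\<dots> \<le> \<kappa> * c1 + \<kappa> * (?B + m * ?x)"
      using h \<kappa>_pos by simp
    finally have "(r - \<sigma>)\<^sup>2 * ?x \<le> \<kappa> * (c1 + ?B + m * ?x)" by (simp add: algebra_simps)
    then have "(r - \<sigma>)\<^sup>2 / \<kappa> * ?x \<le> c1 + ?B + m * ?x" using \<kappa>_pos by (simp add: field_simps)
    then show ?thesis by (simp add: \<delta>1_def algebra_simps)
  qed
  have gain2: "\<delta>2 * w (\<lambda>k. J (e k)) K \<le> w (\<lambda>k. J (h k - m *\<^sub>R e k)) K + c2" for K
  proof -
    have "(r - \<bar>1 - \<alpha> * m\<bar>) * w (\<lambda>k. J (e k)) K
        \<le> r * norm (J (e 0)) + \<alpha> * wnorm r K (\<lambda>k. J (h k - m *\<^sub>R e k))"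
      unfolding w_def using r \<alpha> by (intro wnorm_first_order average) auto
    also have "\<dots> \<le> r * norm (J (e 0)) + \<alpha> * w (\<lambda>k. J (h k - m *\<^sub>R e k)) K"
      unfolding w_def using \<alpha> by (intro add_left_mono mult_left_mono wnorm_le_Suc) auto
    also have "\<dots> = (w (\<lambda>k. J (h k - m *\<^sub>R e k)) K + c2) * \<alpha>"
      using \<alpha> by (simp add: c2_def distrib_right)
    finally show ?thesis using \<alpha> by (simp add: \<delta>2_def pos_divide_le_eq)
  qed

  define \<delta>' where "\<delta>' = min \<delta>1 \<delta>2"
  have \<delta>': "\<delta> < \<delta>'" "\<delta>' \<le> \<delta>1" "\<delta>' \<le> \<delta>2" using \<delta>1 \<delta>2 by (simp_all add: \<delta>'_def)
  have "w e K \<le> sqrt 2 * (c1 + c2) / (\<delta>' - \<delta>)" for K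
  proof -
    let ?b = "w (\<lambda>k. J (e k)) K" and ?t = "w (\<lambda>k. P (e k)) K"
    have "\<delta>' * ?b \<le> w (\<lambda>k. J (h k - m *\<^sub>R e k)) K + (c1 + c2)"
      using gain2[of K] mult_right_mono[OF \<delta>'(3), of ?b] c by simp
    moreover have "\<delta>' * ?t \<le> w (\<lambda>k. P (h k - m *\<^sub>R e k)) K + (c1 + c2)"
      using gain1[of K] mult_right_mono[OF \<delta>'(2), of ?t] c by simp
    moreover have "(w (\<lambda>k. J (h k - m *\<^sub>R e k)) K)\<^sup>2 + (w (\<lambda>k. P (h k - m *\<^sub>R e k)) K)\<^sup>2
        \<le> \<delta>\<^sup>2 * (?b\<^sup>2 + ?t\<^sup>2)"
      unfolding w_def by (intro wnorm_pythagoras_le r \<delta> sector)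
    ultimately have "sqrt (?b\<^sup>2 + ?t\<^sup>2) \<le> sqrt 2 * (c1 + c2) / (\<delta>' - \<delta>)"
      using \<delta> \<delta>'(1) c by (intro small_gain) auto
    moreover have "(w e K)\<^sup>2 + (w (\<lambda>_. 0) K)\<^sup>2 \<le> 1\<^sup>2 * (?b\<^sup>2 + ?t\<^sup>2)"
      unfolding w_def by (intro wnorm_pythagoras_le r) (simp_all add: pythagoras)
    then have "(w e K)\<^sup>2 \<le> ?b\<^sup>2 + ?t\<^sup>2"
      using zero_le_power2[of "w (\<lambda>_. 0) K"] unfolding power_one mult_1 by linarith
    then have "w e K \<le> sqrt (?b\<^sup>2 + ?t\<^sup>2)" by (rule real_le_rsqrt)
    ultimately show ?thesis by linarith
  qed
  then have "(\<lambda>k. r powi (- int k) *\<^sub>R e k) \<longlonglongrightarrow> 0"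
    unfolding w_def by (rule wnorm_bounded_imp_tendsto_0[OF r])
  then show ?thesis by (simp add: e_def X_def)
qed

section \<open>Geometric trajectories\<close>

text \<open>
  If \<open>x k = \<rho>\<^sup>k u \<otimes> e\<close>, the first update forces \<open>y k = \<eta> x k\<close> with the given \<open>\<eta>\<close>, and the second update
  becomes the equation for \<open>\<rho>\<close>. The centres \<open>(1 - \<eta> / m) u \<otimes> e\<close> are chosen such that \<open>y 0 = \<eta> x 0\<close> is
  the initial gradient, so the trajectory contains this mode alone.
\<close>

lemma AugDGM_pure_mode:
  fixes u :: "real^'n::finite" and e :: "real^'d::finite"
  assumes graph: "(nb, W) \<in> graph_class \<sigma>"
    and eigen: "W *v u = \<theta> *\<^sub>R u" and "\<theta> \<noteq> 0" "\<alpha> \<noteq> 0" "m \<noteq> 0"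
    and root: "(\<rho> - \<theta>)\<^sup>2 = - (\<alpha> * \<theta>\<^sup>2 * m * (\<rho> - 1))"
    and \<eta>: "\<eta> = (1 - \<rho> / \<theta>) / \<alpha>"
  shows "AugDGM nb W (\<lambda>i z. m / 2 * (norm (z - ((1 - \<eta> / m) * u $ i) *\<^sub>R e))\<^sup>2) \<alpha>
           (\<lambda>k. \<chi> i. (\<rho> ^ k * u $ i) *\<^sub>R e) (\<lambda>k. \<chi> i. (\<eta> * \<rho> ^ k * u $ i) *\<^sub>R e)"
    (is "AugDGM nb W ?f \<alpha> ?x ?y")
proof -
  define t :: "real \<Rightarrow> (real^'d)^'n" where "t c = (\<chi> i. (c * u $ i) *\<^sub>R e)" for c
  have t_add: "t a + t b = t (a + b)" and t_diff: "t a - t b = t (a - b)"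
    and t_scaleR: "b *\<^sub>R t a = t (b * a)" for a b
    by (simp_all add: t_def vec_eq_iff algebra_simps)
  have t_mix: "mix W (t a) = t (\<theta> * a)" for a
  proof -
    have "(\<Sum>j\<in>UNIV. W $ i $ j * u $ j) = \<theta> * u $ i" for i
      using eigen by (simp add: vec_eq_iff matrix_vector_mult_def)
    then have "(\<Sum>j\<in>UNIV. (W $ i $ j * (a * u $ j)) *\<^sub>R e) = (\<theta> * a * u $ i) *\<^sub>R e" for i
      by (simp add: mult.left_commute[of _ a] mult.assoc flip: scaleR_sum_left sum_distrib_left)
    then show ?thesis by (simp add: vec_eq_iff mix_nth t_def)
  qed
  have t_gradient: "stacked_gradient ?f (t a) = t (m * a - m + \<eta>)" for a
  proof -
    have "gradient (?f i) x = m *\<^sub>R (x - ((1 - \<eta> / m) * u $ i) *\<^sub>R e)" for i x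
      by (rule gradient_shifted_square)
    then have "stacked_gradient ?f (t a) $ i = (m * (a * u $ i - (1 - \<eta> / m) * u $ i)) *\<^sub>R e" for i
      by (simp only: stacked_gradient_def t_def vec_lambda_beta scaleR_diff_left flip: scaleR_scaleR)
    moreover have "m * (a * u $ i - (1 - \<eta> / m) * u $ i) = (m * a - m + \<eta>) * u $ i" for i
      using \<open>m \<noteq> 0\<close> by (simp add: field_simps)
    ultimately show ?thesis by (simp only: vec_eq_iff t_def vec_lambda_beta) simp
  qed
  have \<rho>: "\<theta> * (1 - \<alpha> * \<eta>) = \<rho>" using \<eta> \<open>\<theta> \<noteq> 0\<close> \<open>\<alpha> \<noteq> 0\<close> by (simp add: field_simps)
  have "\<alpha> * \<theta> * (\<rho> * \<eta>) = \<alpha> * \<theta> * (\<theta> * (\<eta> + m * \<rho> - m))"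
    using root \<rho> by (algebra)
  then have \<rho>\<eta>: "\<rho> * \<eta> = \<theta> * (\<eta> + m * \<rho> - m)" using \<open>\<alpha> \<noteq> 0\<close> \<open>\<theta> \<noteq> 0\<close> by simp
  have x_step: "\<rho> ^ Suc k = \<theta> * (\<rho> ^ k - \<alpha> * (\<eta> * \<rho> ^ k))" for k
  proof -
    have "\<rho> ^ Suc k = \<theta> * (1 - \<alpha> * \<eta>) * \<rho> ^ k" by (simp only: \<rho> power_Suc)
    then show ?thesis by (simp add: algebra_simps)
  qed
  have y_step: "\<eta> * \<rho> ^ Suc k
      = \<theta> * (\<eta> * \<rho> ^ k + (m * \<rho> ^ Suc k - m + \<eta>) - (m * \<rho> ^ k - m + \<eta>))" for k
  proof -
    have "\<eta> * \<rho> ^ Suc k = (\<rho> * \<eta>) * \<rho> ^ k" by simp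
    also have "\<dots> = (\<theta> * (\<eta> + m * \<rho> - m)) * \<rho> ^ k" by (simp only: \<rho>\<eta>)
    finally show ?thesis by (simp add: algebra_simps)
  qed
  have "AugDGM nb W ?f \<alpha> (\<lambda>k. t (\<rho> ^ k)) (\<lambda>k. t (\<eta> * \<rho> ^ k))"
    unfolding AugDGM_stacked[OF graph] t_scaleR t_gradient t_add t_diff t_mix
    by (intro conjI allI arg_cong[of _ _ t] x_step y_step) simp
  then show ?thesis by (simp only: t_def mult.assoc)
qed

text \<open>
  A nonzero trajectory \<open>\<rho>\<^sup>k v\<close> does not vanish after division by \<open>t\<^sup>k\<close> for \<open>t \<le> |\<rho>|\<close>. The root \<open>\<rho> = 1\<close>
  of the equation for \<open>\<theta> = 1\<close> has to be excluded: it belongs to the rest position at a consensus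
  point that is the optimum of the shifted objectives.
\<close>

lemma worst_case_rate_ge_mode:
  fixes u :: "real^'n::finite"
  assumes m: "0 < \<mu>" "\<mu> \<le> m" "m \<le> L" and \<alpha>: "0 < \<alpha>"
    and graph: "(nb, W) \<in> graph_class \<sigma>"
    and eigen: "W *v u = \<theta> *\<^sub>R u" "u \<noteq> 0" "\<theta> \<noteq> 0"
    and root: "(\<rho> - \<theta>)\<^sup>2 = - (\<alpha> * \<theta>\<^sup>2 * m * (\<rho> - 1))" "\<rho> \<noteq> 1"
    and t: "t \<le> \<bar>\<rho>\<bar>" "t \<le> 1"
  shows "t \<le> worst_case_rate TYPE('n) TYPE('d::finite) \<mu> L \<sigma> \<alpha>"
proof (rule ccontr)
  let ?w = "worst_case_rate TYPE('n) TYPE('d) \<mu> L \<sigma> \<alpha>"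
  assume less: "\<not> t \<le> ?w"
  then obtain \<gamma>0 where \<gamma>0: "\<gamma>0 \<in> {0..<1}" "converges_at_rate TYPE('n) TYPE('d) \<mu> L \<sigma> \<alpha> \<gamma>0"
    using t(2) unfolding worst_case_rate_def by (auto split: if_splits)
  note wcr = worst_case_rate_least[OF \<gamma>0]
  have t_pos: "0 < t" and t_mem: "t \<in> {?w<..1}" using wcr(1) less t by auto
  define \<eta> where "\<eta> = (1 - \<rho> / \<theta>) / \<alpha>"
  define e :: "real^'d" where "e = 1"
  define c where "c i = ((1 - \<eta> / m) * u $ i) *\<^sub>R e" for i
  define f where "f = (\<lambda>i z. m / 2 * (norm (z - c i))\<^sup>2)"
  define v :: "(real^'d)^'n" where "v = (\<chi> i. u $ i *\<^sub>R e)"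
  have f: "f \<in> strongly_convex_smooth \<mu> L"
    unfolding f_def by (rule shifted_square_strongly_convex_smooth[OF m(2,3)])
  have "AugDGM nb W f \<alpha> (\<lambda>k. \<chi> i. (\<rho> ^ k * u $ i) *\<^sub>R e) (\<lambda>k. \<chi> i. (\<eta> * \<rho> ^ k * u $ i) *\<^sub>R e)"
    unfolding f_def c_def using m \<alpha> by (intro AugDGM_pure_mode[OF graph eigen(1,3) _ _ root(1) \<eta>_def]) auto
  with wcr(2) f graph t_mem
  have "(\<lambda>k. t powi (- int k) *\<^sub>R ((\<chi> i. (\<rho> ^ k * u $ i) *\<^sub>R e) - consensus_optimum f)) \<longlonglongrightarrow> 0"
    unfolding converges_at_rate_def by fast
  moreover have "consensus_optimum f = 0"
  proof -
    \<comment> \<open>The centres sum to 0: for \<open>\<theta> = 1\<close> they are all 0, and otherwise \<open>u\<close> is orthogonal to the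
      eigenvector 1.\<close>
    have "(1 - \<eta> / m) * (\<Sum>i\<in>UNIV. u $ i) = 0"
    proof (cases "\<theta> = 1")
      case True
      with root(1) have "(\<rho> - 1) * (\<rho> - 1) = (- (\<alpha> * m)) * (\<rho> - 1)" by (simp add: power2_eq_square)
      then have "\<rho> - 1 = - (\<alpha> * m)" using root(2) unfolding mult_cancel_right by simp
      then have "\<eta> = m" using \<alpha> True by (simp add: \<eta>_def field_simps)
      then show ?thesis using m by simp
    next
      case False
      have "W *v 1 = 1" "transpose W = W" using graph by (auto simp: graph_class_def)
      then have "1 \<bullet> (W *v u) = 1 \<bullet> u"
        by (metis dot_lmul_matrix vector_transpose_matrix)
      then have "\<theta> * (1 \<bullet> u) = 1 \<bullet> u" by (simp add: eigen(1))
      then have "1 \<bullet> u = 0" using False by simp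
      then show ?thesis by (simp add: inner_vec_def)
    qed
    then have sum_c: "(\<Sum>i\<in>UNIV. c i) = 0"
      unfolding c_def by (simp flip: scaleR_sum_left sum_distrib_left)
    have "consensus_optimum f $ i = 0" for i
    proof -
      have "0 = (\<Sum>j\<in>UNIV. gradient (f j) (consensus_optimum f $ j))"
        by (rule sum_gradient_consensus_optimum[OF f m(1), symmetric])
      also have "\<dots> = (\<Sum>j\<in>UNIV. m *\<^sub>R (consensus_optimum f $ i - c j))"
      proof (intro sum.cong refl)
        fix j
        have "gradient (f j) z = m *\<^sub>R (z - c j)" for z
          unfolding f_def by (rule gradient_shifted_square)
        then show "gradient (f j) (consensus_optimum f $ j) = m *\<^sub>R (consensus_optimum f $ i - c j)"
          using consensus_optimum_eq[OF f m(1), of j i] by simp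
      qed
      also have "\<dots> = (m * real CARD('n)) *\<^sub>R consensus_optimum f $ i"
        by (simp add: sum_subtractf sum_c sum_constant_scaleR del: sum_constant flip: scaleR_sum_right)
      finally show ?thesis using m by simp
    qed
    then show ?thesis by (simp add: vec_eq_iff)
  qed
  moreover have "(\<chi> i. (\<rho> ^ k * u $ i) *\<^sub>R e) = \<rho> ^ k *\<^sub>R v" for k
    by (simp add: v_def vec_eq_iff)
  ultimately have lim: "(\<lambda>k. norm (t powi (- int k) *\<^sub>R \<rho> ^ k *\<^sub>R v)) \<longlonglongrightarrow> 0"
    by (simp add: tendsto_norm_zero del: norm_scaleR)
  have "norm v \<le> norm (t powi (- int k) *\<^sub>R \<rho> ^ k *\<^sub>R v)" for k
  proof -
    have "norm (t powi (- int k) *\<^sub>R \<rho> ^ k *\<^sub>R v) = (\<bar>\<rho>\<bar> / t) ^ k * norm v"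
      using t_pos
      by (simp add: power_int_minus abs_mult power_abs power_divide divide_inverse power_inverse
          power_mult_distrib)
    moreover have "1 \<le> (\<bar>\<rho>\<bar> / t) ^ k" using t t_pos by (intro one_le_power) simp
    ultimately show ?thesis using mult_right_mono[of 1 "(\<bar>\<rho>\<bar> / t) ^ k" "norm v"] by (simp del: norm_scaleR)
  qed
  then have "norm v \<le> 0" using lim by (intro LIMSEQ_le_const[OF lim]) auto
  then have "v = 0" by simp
  then have "u = 0" by (simp add: v_def e_def vec_eq_iff)
  then show False using eigen by simp
qed

section \<open>A graph with eigenvalues 1 and \<open>- \<sigma>\<close>\<close>

text \<open>
  A convex combination of the averaging matrix and the permutation matrix of an involution \<open>\<tau>\<close>.
  For \<open>0 \<le> \<sigma> < 1\<close> its weights are positive, so the graph is complete, and on vectors with sum 0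
  it acts as \<open>\<sigma>\<close> times the permutation, which has the eigenvalue \<open>- 1\<close> unless \<open>\<tau>\<close> is the
  identity. The more obvious \<open>averaging - \<sigma> (I - averaging)\<close> has negative diagonal entries for
  \<open>\<sigma>\<close> near 1 and three or more agents.
\<close>

definition lazy_matching :: "real \<Rightarrow> ('n \<Rightarrow> 'n) \<Rightarrow> real^'n^'n::finite" where
  "lazy_matching \<sigma> \<tau> = (\<chi> i j. (1 - \<sigma>) / real CARD('n) + (if j = \<tau> i then \<sigma> else 0))"

lemma mix_lazy_matching:
  "mix (lazy_matching \<sigma> \<tau>) x $ i = ((1 - \<sigma>) / real CARD('n)) *\<^sub>R (\<Sum>j\<in>UNIV. x $ j) + \<sigma> *\<^sub>R x $ (\<tau> i)"
  for x :: "('a::real_vector)^'n::finite"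
proof -
  have "(if j = \<tau> i then \<sigma> else 0) *\<^sub>R x $ j = (if j = \<tau> i then \<sigma> *\<^sub>R x $ j else 0)" for j by simp
  then show ?thesis
    by (simp add: mix_nth lazy_matching_def scaleR_add_left sum.distrib scaleR_sum_right)
qed

lemma lazy_matching_in_graph_class:
  fixes \<tau> :: "'n::finite \<Rightarrow> 'n"
  assumes \<tau>: "\<And>i. \<tau> (\<tau> i) = i" and \<sigma>: "0 \<le> \<sigma>" "\<sigma> < 1"
  shows "((\<lambda>_. UNIV), lazy_matching \<sigma> \<tau>) \<in> graph_class \<sigma>"
proof -
  let ?W = "lazy_matching \<sigma> \<tau>"
  let ?A = "map_matrix complex_of_real (?W - (\<chi> i j. 1 / real CARD('n)))"
  have bij: "bij \<tau>" by (rule o_bij[of \<tau>]) (auto simp: fun_eq_iff \<tau>)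
  have pos: "?W $ i $ j > 0" for i j
    using \<sigma> by (auto simp: lazy_matching_def intro!: add_pos_nonneg)
  have "j = \<tau> i \<longleftrightarrow> i = \<tau> j" for i j by (metis \<tau>)
  then have sym: "transpose ?W = ?W"
    by (simp add: transpose_def lazy_matching_def vec_eq_iff)
  have one: "?W *v 1 = 1"
    by (simp add: vec_eq_iff matrix_vector_mult_def lazy_matching_def sum.distrib)
  have A: "?A $ i $ j = complex_of_real \<sigma> * ((if j = \<tau> i then 1 else 0) - 1 / of_nat CARD('n))" for i j
    by (simp add: lazy_matching_def field_simps)
  have mult: "(?A *v v) $ i = complex_of_real \<sigma> * (v $ (\<tau> i) - (\<Sum>j\<in>UNIV. v $ j) / of_nat CARD('n))"
    for v i
  proof -
    have "((if j = \<tau> i then 1 else 0) - 1 / of_nat CARD('n)) * v $ j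
        = (if j = \<tau> i then v $ j else 0) - v $ j / of_nat CARD('n)" for j by (simp add: algebra_simps)
    then have "(\<Sum>j\<in>UNIV. ((if j = \<tau> i then 1 else 0) - 1 / of_nat CARD('n)) * v $ j)
        = v $ (\<tau> i) - (\<Sum>j\<in>UNIV. v $ j) / of_nat CARD('n)"
      by (simp add: sum_subtractf sum_divide_distrib)
    then show ?thesis
      unfolding matrix_vector_mult_def by (simp only: A vec_lambda_beta mult.assoc flip: sum_distrib_left)
  qed
  have bound: "cmod z \<le> \<sigma>" if ev: "?A *v v = z *s v" and "v \<noteq> 0" for z v
  proof (cases "z = 0")
    case False
    have ev': "z * v $ i = complex_of_real \<sigma> * (v $ (\<tau> i) - (\<Sum>j\<in>UNIV. v $ j) / of_nat CARD('n))" for i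
      using ev mult[of v i] by simp
    have "(\<Sum>i\<in>UNIV. v $ (\<tau> i)) = (\<Sum>i\<in>UNIV. v $ i)"
      using bij by (rule sum.reindex_bij_betw)
    then have "z * (\<Sum>i\<in>UNIV. v $ i) = 0"
      unfolding sum_distrib_left ev' by (simp add: sum_subtractf flip: sum_distrib_left)
    then have "z * v $ i = complex_of_real \<sigma> * v $ (\<tau> i)" for i
      using False ev' by simp
    then have eq: "cmod z * cmod (v $ i) = \<sigma> * cmod (v $ (\<tau> i))" for i
      using \<sigma> by (metis norm_mult norm_of_real abs_of_nonneg)
    \<comment> \<open>At an entry of largest modulus the eigenvalue equation gives \<open>|z| \<le> \<sigma>\<close>.\<close>
    obtain i where i: "\<And>j. cmod (v $ j) \<le> cmod (v $ i)"
    proof -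
      have "Max (range (\<lambda>j. cmod (v $ j))) \<in> range (\<lambda>j. cmod (v $ j))" by (rule Max_in) auto
      then obtain i where "Max (range (\<lambda>j. cmod (v $ j))) = cmod (v $ i)" by blast
      then have "cmod (v $ j) \<le> cmod (v $ i)" for j
        by (metis Max_ge finite_imageI finite rangeI)
      then show thesis by (rule that)
    qed
    have "cmod z * cmod (v $ i) \<le> \<sigma> * cmod (v $ i)"
      unfolding eq using i \<sigma> by (simp add: mult_left_mono)
    moreover have "cmod (v $ i) > 0"
    proof (rule ccontr)
      assume "\<not> cmod (v $ i) > 0"
      then have "cmod (v $ j) \<le> 0" for j using i[of j] by linarith
      then show False using \<open>v \<noteq> 0\<close> by (simp add: vec_eq_iff)
    qed
    ultimately show ?thesis by simp
  qed (use \<sigma> in simp)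
  have "?A *v 1 = 0 *s 1" by (simp add: vec_eq_iff mult)
  then have "\<exists>v. v \<noteq> 0 \<and> ?A *v v = 0 *s v" by (metis one_neq_zero)
  then have "spectral_radius ?A \<le> \<sigma>"
    unfolding spectral_radius_def using bound by (intro cSup_least) blast+
  moreover have "(UNIV :: ('n \<times> 'n) set)\<^sup>* = UNIV" by auto
  ultimately show ?thesis
    using pos sym one \<sigma> by (simp add: graph_class_def consensus_norm_def)
qed

lemma lazy_matching_eigenvectors:
  fixes \<tau> :: "'n::finite \<Rightarrow> 'n"
  assumes \<tau>: "\<And>i. \<tau> (\<tau> i) = i"
  shows lazy_matching_constant: "lazy_matching \<sigma> \<tau> *v 1 = 1 *\<^sub>R 1"
    and lazy_matching_antisymmetric:
      "lazy_matching \<sigma> \<tau> *v (axis a 1 - axis (\<tau> a) 1) = (- \<sigma>) *\<^sub>R (axis a 1 - axis (\<tau> a) 1)"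
proof -
  show "lazy_matching \<sigma> \<tau> *v 1 = 1 *\<^sub>R 1"
    by (simp add: vec_eq_iff mix_lazy_matching flip: mix_real)
  have "\<tau> i = a \<longleftrightarrow> i = \<tau> a" "\<tau> i = \<tau> a \<longleftrightarrow> i = a" for i by (metis \<tau>)+
  then show "lazy_matching \<sigma> \<tau> *v (axis a 1 - axis (\<tau> a) 1) = (- \<sigma>) *\<^sub>R (axis a 1 - axis (\<tau> a) 1)"
    by (simp add: vec_eq_iff mix_lazy_matching sum_subtractf axis_def flip: mix_real)
qed

section \<open>The optimal rate\<close>

text \<open>
  With \<open>\<alpha> = (1 - g) / \<mu>\<close>, the third and fourth claim are \<open>\<alpha> L - 1 \<le> g\<close> and \<open>\<alpha> \<sigma>\<^sup>2 L (1 + g) \<le> (g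
  - \<sigma>)\<^sup>2\<close> after clearing denominators, and the last claim says that one of them is an equality.
  The gradient descent rate \<open>r0\<close> solves \<open>\<alpha> L - 1 = g\<close>. Given \<open>\<sigma> \<le> r0\<close>, it satisfies the fourth
  claim iff \<open>\<sigma> \<le> (1 - \<rho>) / (3 + \<rho>)\<close>, because \<open>1 - r0\<^sup>2\<close> is \<open>\<rho>\<close> times the square of \<open>2 / (1 +
  \<rho>)\<close>. Beyond this threshold \<open>g\<close> is the larger root of the quadratic equation for equality in
  the fourth claim.
\<close>

lemma gamma_AD_properties:
  assumes \<mu>: "0 < \<mu>" "\<mu> \<le> L" and \<sigma>: "0 \<le> \<sigma>" "\<sigma> < 1"
  defines "g \<equiv> gamma_AD \<mu> L \<sigma>"
  shows gamma_AD_less_1: "g < 1"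
    and gamma_AD_ge_sigma: "\<sigma> \<le> g"
    and gamma_AD_ge_gradient_descent: "L * (1 - g) \<le> \<mu> * (1 + g)"
    and gamma_AD_disagreement: "L * \<sigma>\<^sup>2 * (1 - g\<^sup>2) \<le> \<mu> * (g - \<sigma>)\<^sup>2"
    and gamma_AD_tight: "L * (1 - g) = \<mu> * (1 + g) \<or> 0 < \<sigma> \<and> L * \<sigma>\<^sup>2 * (1 - g\<^sup>2) = \<mu> * (g - \<sigma>)\<^sup>2"
proof -
  define \<rho> where "\<rho> = \<mu> / L"
  have L: "0 < L" and \<rho>: "0 < \<rho>" "\<rho> \<le> 1" and \<mu>_eq: "\<mu> = L * \<rho>" using \<mu> by (simp_all add: \<rho>_def)
  define r0 where "r0 = (1 - \<rho>) / (1 + \<rho>)"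
  have r0_sq: "\<rho> * (2 / (1 + \<rho>))\<^sup>2 = 1 - r0\<^sup>2"
    using \<rho> by (simp add: r0_def power_divide field_simps) (simp add: power2_eq_square algebra_simps)
  have r0_eq: "1 - r0 = \<rho> * (1 + r0)" using \<rho> by (simp add: r0_def field_simps)
  have r0_sigma: "\<sigma> \<le> (1 - \<rho>) / (3 + \<rho>) \<longleftrightarrow> 2 / (1 + \<rho>) * \<sigma> \<le> r0 - \<sigma>"
  proof -
    have "2 / (1 + \<rho>) * \<sigma> \<le> r0 - \<sigma> \<longleftrightarrow> (3 + \<rho>) / (1 + \<rho>) * \<sigma> \<le> (1 - \<rho>) / (1 + \<rho>)"
    proof -
      have "(3 + \<rho>) / (1 + \<rho>) = 2 / (1 + \<rho>) + 1" using \<rho> by (simp add: field_simps)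
      then show ?thesis by (simp add: r0_def distrib_right le_diff_eq)
    qed
    also have "\<dots> \<longleftrightarrow> (3 + \<rho>) * \<sigma> \<le> 1 - \<rho>"
      using \<rho> by (simp add: divide_le_cancel)
    finally show ?thesis using \<rho> by (simp add: pos_le_divide_eq mult.commute)
  qed
  have "g < 1 \<and> \<sigma> \<le> g \<and> r0 \<le> g \<and> \<sigma>\<^sup>2 * (1 - g\<^sup>2) \<le> \<rho> * (g - \<sigma>)\<^sup>2
      \<and> (g = r0 \<or> 0 < \<sigma> \<and> \<sigma>\<^sup>2 * (1 - g\<^sup>2) = \<rho> * (g - \<sigma>)\<^sup>2)"
  proof (cases "\<sigma> \<le> (1 - \<rho>) / (3 + \<rho>)")
    case True
    have "(L - \<mu>) / (L + \<mu>) = (L * (1 - \<rho>)) / (L * (1 + \<rho>))" by (simp add: \<mu>_eq algebra_simps)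
    then have g: "g = r0"
      using True L by (simp add: g_def gamma_AD_def Let_def r0_def flip: \<rho>_def)
    have le: "2 / (1 + \<rho>) * \<sigma> \<le> r0 - \<sigma>" using True r0_sigma by simp
    have nn: "0 \<le> 2 / (1 + \<rho>) * \<sigma>" using \<rho> \<sigma> by simp
    have "\<sigma>\<^sup>2 * (1 - r0\<^sup>2) = \<rho> * (2 / (1 + \<rho>) * \<sigma>)\<^sup>2"
      unfolding r0_sq[symmetric] power_mult_distrib by (simp only: mult_ac)
    also have "\<dots> \<le> \<rho> * (r0 - \<sigma>)\<^sup>2"
      using \<rho> le nn by (intro mult_left_mono power_mono) auto
    finally have "\<sigma>\<^sup>2 * (1 - r0\<^sup>2) \<le> \<rho> * (r0 - \<sigma>)\<^sup>2" .
    moreover have "r0 < 1" using \<rho> by (simp add: r0_def)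
    moreover have "\<sigma> \<le> r0" using le nn by linarith
    ultimately show ?thesis by (simp add: g)
  next
    case False
    define s where "s = sqrt (\<rho> + \<sigma>\<^sup>2 - \<sigma>\<^sup>2 * \<rho>)"
    define D where "D = \<sigma>\<^sup>2 + \<rho>"
    have "0 \<le> (1 - \<rho>) / (3 + \<rho>)" using \<rho> by simp
    then have \<sigma>_pos: "0 < \<sigma>" using False by linarith
    have \<sigma>2: "\<sigma>\<^sup>2 < 1" using \<sigma> by (simp add: power_less_one_iff)
    have D: "0 < D" using \<rho> by (simp add: D_def add_nonneg_pos)
    have rad: "\<rho> + \<sigma>\<^sup>2 - \<sigma>\<^sup>2 * \<rho> = \<sigma>\<^sup>2 * \<sigma>\<^sup>2 + D * (1 - \<sigma>\<^sup>2)" by (simp add: D_def algebra_simps)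
    have rad_ge: "(\<sigma>\<^sup>2)\<^sup>2 \<le> \<rho> + \<sigma>\<^sup>2 - \<sigma>\<^sup>2 * \<rho>" unfolding rad using D \<sigma>2 by (simp add: power2_eq_square)
    then have s: "\<sigma>\<^sup>2 \<le> s" unfolding s_def by (rule real_le_rsqrt)
    have s2: "s\<^sup>2 = \<rho> + \<sigma>\<^sup>2 - \<sigma>\<^sup>2 * \<rho>"
      unfolding s_def using rad_ge by (intro real_sqrt_pow2) (meson order_trans zero_le_power2)
    have "g = (\<sigma> * \<rho> + \<sigma> * s) / D"
      using False by (simp add: g_def gamma_AD_def Let_def s_def D_def flip: \<rho>_def)
    then have Dg: "D * g = \<sigma> * (\<rho> + s)" using D by (simp add: field_simps)
    \<comment> \<open>Multiplying by \<open>D\<close> allows the value of \<open>D g\<close> to be inserted without division.\<close>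
    have "D * (\<rho> * (g - \<sigma>)\<^sup>2 - \<sigma>\<^sup>2 * (1 - g\<^sup>2)) = (D * g)\<^sup>2 - 2 * \<rho> * \<sigma> * (D * g) + D * (\<rho> * \<sigma>\<^sup>2 - \<sigma>\<^sup>2)"
      unfolding D_def by algebra
    also have "\<dots> = \<sigma>\<^sup>2 * (s\<^sup>2 - \<rho>\<^sup>2 + D * (\<rho> - 1))"
      unfolding Dg by algebra
    also have "\<dots> = 0" unfolding s2 D_def by algebra
    finally have tight: "\<sigma>\<^sup>2 * (1 - g\<^sup>2) = \<rho> * (g - \<sigma>)\<^sup>2" using D by simp
    have "\<sigma> * D \<le> \<sigma> * (\<rho> + s)" using s \<sigma> by (intro mult_left_mono) (simp_all add: D_def)
    then have "D * \<sigma> \<le> D * g" unfolding Dg by (simp add: mult.commute)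
    then have \<sigma>g: "\<sigma> \<le> g" using D by simp
    have g1: "g < 1"
    proof (rule ccontr)
      assume "\<not> g < 1"
      then have "1 \<le> g\<^sup>2" "0 < \<rho> * (g - \<sigma>)\<^sup>2" using \<rho> \<sigma> by simp_all
      then show False using tight[symmetric] \<sigma>_pos by (simp add: zero_less_mult_iff)
    qed
    have "r0 \<le> g"
    proof (rule ccontr)
      assume "\<not> r0 \<le> g"
      then have "g - \<sigma> \<le> 2 / (1 + \<rho>) * \<sigma>" "g\<^sup>2 < r0\<^sup>2"
        using False r0_sigma \<sigma>g \<sigma> by (auto intro: power_strict_mono)
      then have "\<rho> * (g - \<sigma>)\<^sup>2 \<le> \<rho> * (2 / (1 + \<rho>) * \<sigma>)\<^sup>2"
        using \<rho> \<sigma>g by (intro mult_left_mono power_mono) auto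
      also have "\<dots> = \<sigma>\<^sup>2 * (1 - r0\<^sup>2)"
        unfolding r0_sq[symmetric] power_mult_distrib by (simp only: mult_ac)
      also have "\<dots> < \<sigma>\<^sup>2 * (1 - g\<^sup>2)" using \<open>g\<^sup>2 < r0\<^sup>2\<close> \<sigma>_pos by simp
      finally show False using tight by simp
    qed
    then show ?thesis using g1 \<sigma>g tight \<sigma>_pos by simp
  qed
  then have props: "g < 1" "\<sigma> \<le> g" "r0 \<le> g" "\<sigma>\<^sup>2 * (1 - g\<^sup>2) \<le> \<rho> * (g - \<sigma>)\<^sup>2"
    "g = r0 \<or> 0 < \<sigma> \<and> \<sigma>\<^sup>2 * (1 - g\<^sup>2) = \<rho> * (g - \<sigma>)\<^sup>2" by auto
  show "g < 1" "\<sigma> \<le> g" by (fact props)+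
  have "\<rho> * (1 + r0) \<le> \<rho> * (1 + g)" using \<rho> props by simp
  then have "1 - g \<le> \<rho> * (1 + g)" using r0_eq props by linarith
  then show "L * (1 - g) \<le> \<mu> * (1 + g)" using L by (simp add: \<mu>_eq mult.assoc)
  show "L * \<sigma>\<^sup>2 * (1 - g\<^sup>2) \<le> \<mu> * (g - \<sigma>)\<^sup>2" using props(4) L by (simp add: \<mu>_eq mult.assoc)
  show "L * (1 - g) = \<mu> * (1 + g) \<or> 0 < \<sigma> \<and> L * \<sigma>\<^sup>2 * (1 - g\<^sup>2) = \<mu> * (g - \<sigma>)\<^sup>2"
    using props(5) r0_eq L by (auto simp: \<mu>_eq mult.assoc)
qed

text \<open>
  At \<open>r = g\<close> the two conditions for convergence hold with \<open>\<le>\<close>. They become strict for \<open>r > g\<close>: in the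
  second one the left-hand side grows with slope \<open>C \<le> g - \<sigma>\<close>, more slowly than \<open>(r - \<sigma>)\<^sup>2\<close>.
\<close>

lemma AugDGM_rate_upper:
  assumes \<mu>: "0 < \<mu>" "\<mu> \<le> L" and \<sigma>: "0 \<le> \<sigma>" "\<sigma> < 1"
  defines "g \<equiv> gamma_AD \<mu> L \<sigma>"
  shows "converges_at_rate TYPE('n::finite) TYPE('d::finite) \<mu> L \<sigma> ((1 - g) / \<mu>) g"
proof -
  define \<alpha> where "\<alpha> = (1 - g) / \<mu>"
  note props = gamma_AD_properties[OF \<mu> \<sigma>, folded g_def]
  have \<alpha>: "0 < \<alpha>" and \<alpha>\<mu>: "\<alpha> * \<mu> = 1 - g" using props(1) \<mu> by (simp_all add: \<alpha>_def)
  have \<alpha>L: "\<alpha> * L \<le> 1 + g"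
    using props(3) \<mu> by (simp add: \<alpha>_def field_simps)
  define C where "C = \<alpha> * \<sigma>\<^sup>2 * L"
  have "\<mu> * (C * (1 + g)) = L * \<sigma>\<^sup>2 * (1 - g\<^sup>2)"
  proof -
    have "\<mu> * (C * (1 + g)) = (\<alpha> * \<mu>) * (L * \<sigma>\<^sup>2 * (1 + g))" by (simp add: C_def)
    then show ?thesis unfolding \<alpha>\<mu> by (simp add: power2_eq_square algebra_simps)
  qed
  then have C: "C * (1 + g) \<le> (g - \<sigma>)\<^sup>2"
    using props(4) \<mu> by (metis mult_le_cancel_left_pos)
  have g1: "0 < 1 + g" using props(2) \<sigma> by linarith
  have "(g - \<sigma>)\<^sup>2 \<le> (g - \<sigma>) * (1 + g)"
    unfolding power2_eq_square using props(2) \<sigma> by (intro mult_left_mono) auto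
  with C have "C * (1 + g) \<le> (g - \<sigma>) * (1 + g)" by linarith
  then have C': "C \<le> g - \<sigma>" using g1 by simp
  have "(\<lambda>k. r powi (- int k) *\<^sub>R (x k - consensus_optimum f)) \<longlonglongrightarrow> 0"
    if r: "g < r" and f: "f \<in> strongly_convex_smooth \<mu> L" and graph: "(nb, W) \<in> graph_class \<sigma>"
      and run: "AugDGM nb W f \<alpha> x y"
    for r nb W and f :: "'n \<Rightarrow> real^'d \<Rightarrow> real" and x y
  proof (rule AugDGM_converges[OF \<mu> \<sigma>(1) \<alpha> f graph run])
    define A where "A = \<alpha> * ((L + \<mu>) / 2)"
    define D where "D = \<alpha> * ((L - \<mu>) / 2)"
    have "A - D = \<alpha> * \<mu>" "A + D = \<alpha> * L" by (simp_all add: A_def D_def field_simps)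
    then have "1 - A + D < r" "A - 1 + D < r" using \<alpha>\<mu> \<alpha>L r by simp_all
    then show "\<bar>1 - \<alpha> * ((L + \<mu>) / 2)\<bar> + \<alpha> * ((L - \<mu>) / 2) < r"
      unfolding A_def[symmetric] D_def[symmetric] by (cases "A \<le> 1") simp_all
    show "\<sigma> < r" using props(2) r by linarith
    have "C * (1 + r) = C * (1 + g) + C * (r - g)" by (simp add: algebra_simps)
    also have "\<dots> \<le> (g - \<sigma>)\<^sup>2 + (g - \<sigma>) * (r - g)"
      using C C' r by (intro add_mono mult_right_mono) auto
    also have "\<dots> < (g - \<sigma>)\<^sup>2 + (g - \<sigma>) * (r - g) + ((g - \<sigma>) * (r - g) + (r - g)\<^sup>2)"
      using props(2) r by (simp add: add_nonneg_pos)
    also have "\<dots> = (r - \<sigma>)\<^sup>2" by (simp add: power2_eq_square algebra_simps)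
    finally show "\<alpha> * \<sigma>\<^sup>2 * (1 + r) * L < (r - \<sigma>)\<^sup>2" by (simp add: C_def algebra_simps)
  qed
  then show ?thesis unfolding converges_at_rate_def \<alpha>_def by auto
qed

text \<open>
  A step size below the optimal one makes the mode \<open>1 - \<alpha> \<mu>\<close> slow. For a larger one, the bound that is
  tight at the optimal step size only gets worse: either the mode \<open>1 - \<alpha> L\<close> overshoots, or the mode on
  the eigenvalue \<open>- \<sigma>\<close> is slow.
\<close>

lemma AugDGM_rate_lower:
  assumes \<mu>: "0 < \<mu>" "\<mu> \<le> L" and \<sigma>: "0 \<le> \<sigma>" "\<sigma> < 1"
    and card: "CARD('n::finite) \<ge> 2" and \<alpha>: "0 < \<alpha>"
  shows "gamma_AD \<mu> L \<sigma> \<le> worst_case_rate TYPE('n) TYPE('d::finite) \<mu> L \<sigma> \<alpha>"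
proof -
  define g where "g = gamma_AD \<mu> L \<sigma>"
  note props = gamma_AD_properties[OF \<mu> \<sigma>, folded g_def]
  obtain a b :: 'n where ab: "a \<noteq> b"
  proof -
    have "\<exists>a b :: 'n. a \<noteq> b"
    proof (rule ccontr)
      assume "\<not> (\<exists>a b :: 'n. a \<noteq> b)"
      then have "(UNIV :: 'n set) = {undefined}" by auto
      then have "CARD('n) = card {undefined :: 'n}" by simp
      then show False using card by simp
    qed
    then show thesis using that by blast
  qed
  define \<tau> where "\<tau> i = (if i = a then b else if i = b then a else i)" for i
  have \<tau>: "\<tau> (\<tau> i) = i" for i by (simp add: \<tau>_def)
  have graph: "((\<lambda>_. UNIV), lazy_matching \<sigma> \<tau>) \<in> graph_class \<sigma>"
    using \<tau> \<sigma> by (rule lazy_matching_in_graph_class)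
  have consensus_mode: "t \<le> worst_case_rate TYPE('n) TYPE('d) \<mu> L \<sigma> \<alpha>"
    if "\<mu> \<le> m" "m \<le> L" "t \<le> \<bar>1 - \<alpha> * m\<bar>" "t \<le> 1" for m t
    using that \<alpha> \<mu>(1)
    by (intro worst_case_rate_ge_mode[OF \<mu>(1) that(1,2) \<alpha> graph lazy_matching_constant[OF \<tau>], of "1 - \<alpha> * m"])
       (auto simp: power2_eq_square)
  show ?thesis
  proof (cases "1 - \<alpha> * \<mu> < g")
    case False
    then show ?thesis using consensus_mode[of \<mu> g] \<mu> props(1) by (simp add: g_def)
  next
    case small: True
    from props(5) show ?thesis
    proof
      assume eq: "L * (1 - g) = \<mu> * (1 + g)"
      have "L * (1 - g) < L * (\<alpha> * \<mu>)"
        using small \<mu> by (intro mult_strict_left_mono) auto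
      then have "\<mu> * (1 + g) < \<mu> * (\<alpha> * L)" unfolding eq by (simp add: mult_ac)
      then have "g \<le> \<bar>1 - \<alpha> * L\<bar>" using \<mu> by simp
      then show ?thesis using consensus_mode[of L g] \<mu> props(1) by (simp add: g_def)
    next
      assume tight: "0 < \<sigma> \<and> L * \<sigma>\<^sup>2 * (1 - g\<^sup>2) = \<mu> * (g - \<sigma>)\<^sup>2"
      define C where "C = \<alpha> * \<sigma>\<^sup>2 * L"
      have C: "0 < C" using tight \<alpha> \<mu> by (simp add: C_def)
      \<comment> \<open>The left-hand side of the equation for \<open>s\<close> exceeds the right-hand side by \<open>(1 + \<sigma>)\<^sup>2\<close> at \<open>b'\<close>.\<close>
      define b' where "b' = \<sigma> + (C + 1 + \<sigma>)"
      have "\<exists>s\<ge>g. s \<le> b' \<and> (s - \<sigma>)\<^sup>2 - C * (1 + s) = 0"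
      proof (rule IVT')
        have "\<mu> * (g - \<sigma>)\<^sup>2 = (1 - g) * (L * \<sigma>\<^sup>2 * (1 + g))"
          using tight by (simp add: power2_eq_square algebra_simps)
        also have "\<dots> \<le> (\<alpha> * \<mu>) * (L * \<sigma>\<^sup>2 * (1 + g))"
          using small \<mu> props(2) \<sigma> by (intro mult_right_mono) auto
        finally have "\<mu> * (g - \<sigma>)\<^sup>2 \<le> \<mu> * (C * (1 + g))" by (simp add: C_def mult_ac)
        then show "(g - \<sigma>)\<^sup>2 - C * (1 + g) \<le> 0" using \<mu> by simp
        have "(b' - \<sigma>)\<^sup>2 - C * (1 + b') = (1 + \<sigma>)\<^sup>2"
          by (simp add: b'_def power2_eq_square algebra_simps)
        then show "0 \<le> (b' - \<sigma>)\<^sup>2 - C * (1 + b')" by simp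
        show "g \<le> b'" using props(1) C \<sigma> by (simp add: b'_def)
        show "continuous_on {g..b'} (\<lambda>s. (s - \<sigma>)\<^sup>2 - C * (1 + s))" by (intro continuous_intros)
      qed
      then obtain s where s: "g \<le> s" "(s - \<sigma>)\<^sup>2 = C * (1 + s)" by auto
      have "\<tau> a = b" by (simp add: \<tau>_def)
      then have "(axis a 1 - axis (\<tau> a) 1) \<noteq> (0 :: real^'n)"
        using ab by (auto simp: vec_eq_iff axis_def intro!: exI[of _ a])
      then show ?thesis
        unfolding g_def[symmetric]
      proof (rule worst_case_rate_ge_mode[OF \<mu> order_refl \<alpha> graph lazy_matching_antisymmetric[OF \<tau>],
            of a "- s"])
        show "- \<sigma> \<noteq> 0" using tight by simp
        show "(- s - - \<sigma>)\<^sup>2 = - (\<alpha> * (- \<sigma>)\<^sup>2 * L * (- s - 1))"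
          using s(2) by (simp add: C_def power2_eq_square algebra_simps)
        show "- s \<noteq> 1" using s(1) props(2) \<sigma> by linarith
        show "g \<le> \<bar>- s\<bar>" using s(1) by simp
        show "g \<le> 1" using props(1) by simp
      qed
    qed
  qed
qed

theorem theorem2:
  fixes \<mu> L \<sigma> \<alpha>\<^sub>A\<^sub>D :: real
  assumes "0 < \<mu>" and "\<mu> \<le> L"
    and "0 \<le> \<sigma>" and "\<sigma> < 1"
    and "CARD('n::finite) \<ge> 2"
    and "\<alpha>\<^sub>A\<^sub>D = (1 - gamma_AD \<mu> L \<sigma>) / \<mu>"
  shows "\<alpha>\<^sub>A\<^sub>D > 0 \<and>
    worst_case_rate TYPE('n) TYPE('d::finite) \<mu> L \<sigma> \<alpha>\<^sub>A\<^sub>D = gamma_AD \<mu> L \<sigma> \<and>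
    (\<forall>\<alpha>>0. gamma_AD \<mu> L \<sigma> \<le> worst_case_rate TYPE('n) TYPE('d) \<mu> L \<sigma> \<alpha>)"
proof -
  have g: "gamma_AD \<mu> L \<sigma> < 1" "\<sigma> \<le> gamma_AD \<mu> L \<sigma>"
    using gamma_AD_properties[OF assms(1-4)] by auto
  have lower: "gamma_AD \<mu> L \<sigma> \<le> worst_case_rate TYPE('n) TYPE('d) \<mu> L \<sigma> \<alpha>" if "\<alpha> > 0" for \<alpha>
    using AugDGM_rate_lower[OF assms(1-5) that] .
  have pos: "\<alpha>\<^sub>A\<^sub>D > 0" using g assms by simp
  have "worst_case_rate TYPE('n) TYPE('d) \<mu> L \<sigma> \<alpha>\<^sub>A\<^sub>D \<le> gamma_AD \<mu> L \<sigma>"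
    using AugDGM_rate_upper[OF assms(1-4)] g assms(3) unfolding assms(6)
    by (intro worst_case_rate_least(3)) auto
  with lower[OF pos] have "worst_case_rate TYPE('n) TYPE('d) \<mu> L \<sigma> \<alpha>\<^sub>A\<^sub>D = gamma_AD \<mu> L \<sigma>"
    by (intro antisym)
  with lower pos show ?thesis by blast
qed

end
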